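(* Let $\ell\ge 3$ be a fixed integer and let $H=C_{2\ell-1}$ be the cycle of length $2\ell-1$. Then for all sufficiently large $n$, $$\mathrm{ex}_r(n, C_{2\ell-1})=\begin{cases} \frac n2 & \text{if } n \text{ is even},\\ 2 \left\lfloor \frac n{2\ell+1} \right\rfloor & \text{if } n \text{ is odd}.\end{cases}$$
   Context: For a graph $H$ and a positive integer $n$, the regular Turán number $\mathrm{ex}_r(n,H)$ is the maximum integer $k$ such that there exists a $k$-regular graph $G$ on $n$ vertices that does not contain $H$ as a (not necessarily induced) subgraph. Graphs are finite and simple. *)

theory Defs
  imports "Graph_Theory.Graph_Theory"
begin

(* Finite simple graphs are the pair_graphs of Graph_Theory: every edge is the pair of
   opposite arcs (u,v) and (v,u), so the degree of a vertex is its out-degree. *)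

definition k_regular :: "nat \<Rightarrow> 'a pair_pre_digraph \<Rightarrow> bool" where
  "k_regular k G \<longleftrightarrow> (\<forall>v \<in> pverts G. out_degree (with_proj G) v = k)"

(* The copy S of H need not be induced. *)
definition contains_graph :: "'a pair_pre_digraph \<Rightarrow> 'b pair_pre_digraph \<Rightarrow> bool" where
  "contains_graph G H \<longleftrightarrow>
     (\<exists>S. subgraph S (with_proj G) \<and> digraph_iso (with_proj H) S)"

(* C_m for m \<ge> 3; smaller m are degenerate (a loop for m = 1, a single edge for m = 2). *)
definition cycle_graph :: "nat \<Rightarrow> nat pair_pre_digraph" where
  "cycle_graph m =
     \<lparr> pverts = {..<m},
       parcs = {(i, j). i < m \<and> j < m \<and> (j = Suc i mod m \<or> i = Suc j mod m)} \<rparr>"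

definition regular_free_degrees :: "nat \<Rightarrow> 'b pair_pre_digraph \<Rightarrow> nat set" where
  "regular_free_degrees n H =
     {k. \<exists>G :: nat pair_pre_digraph.
           pair_graph G \<and> card (pverts G) = n \<and> k_regular k G \<and> \<not> contains_graph G H}"

definition regular_turan_number :: "nat \<Rightarrow> 'b pair_pre_digraph \<Rightarrow> nat" where
  "regular_turan_number n H = Max (regular_free_degrees n H)"

lemma contains_graph_iff:
  assumes "pair_wf_digraph G" "pair_wf_digraph H"
  shows "contains_graph G H \<longleftrightarrow>
    (\<exists>f. inj_on f (pverts H) \<and> f ` pverts H \<subseteq> pverts G \<and>
         (\<forall>(u, v) \<in> parcs H. (f u, f v) \<in> parcs G))"
proof
  interpret H: pair_wf_digraph H by (rule assms)
  assume "contains_graph G H"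
  then obtain h where h: "pre_digraph.digraph_isomorphism (with_proj H) h"
    and s: "subgraph (app_iso h (with_proj H)) (with_proj G)"
    unfolding contains_graph_def digraph_iso_def by blast
  have th: "iso_tail h = fst" "iso_head h = snd"
    using s by (auto simp: subgraph_def compatible_def)
  have "(iso_verts h u, iso_verts h v) \<in> parcs G" if "(u, v) \<in> parcs H" for u v
  proof -
    have "iso_verts h u = fst (iso_arcs h (u, v))" "iso_verts h v = snd (iso_arcs h (u, v))"
      using h that th by (force simp: pre_digraph.digraph_isomorphism_def)+
    moreover have "iso_arcs h (u, v) \<in> parcs G"
      using s that by (auto simp: subgraph_def)
    ultimately show ?thesis by simp
  qed
  moreover have "iso_verts h ` pverts H \<subseteq> pverts G"
    using s by (auto simp: subgraph_def)
  moreover have "inj_on (iso_verts h) (pverts H)"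
    using h by (simp add: pre_digraph.digraph_isomorphism_def)
  ultimately show "\<exists>f. inj_on f (pverts H) \<and> f ` pverts H \<subseteq> pverts G \<and>
         (\<forall>(u, v) \<in> parcs H. (f u, f v) \<in> parcs G)"
    by blast
next
  interpret G: pair_wf_digraph G by (rule assms)
  interpret H: pair_wf_digraph H by (rule assms)
  assume "\<exists>f. inj_on f (pverts H) \<and> f ` pverts H \<subseteq> pverts G \<and>
         (\<forall>(u, v) \<in> parcs H. (f u, f v) \<in> parcs G)"
  then obtain f where f: "inj_on f (pverts H)" "f ` pverts H \<subseteq> pverts G"
    "\<And>u v. (u, v) \<in> parcs H \<Longrightarrow> (f u, f v) \<in> parcs G" by fast
  define h where "h = \<lparr> iso_verts = f, iso_arcs = map_prod f f, iso_head = snd, iso_tail = fst \<rparr>"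
  have "inj_on (map_prod f f) (parcs H)"
  proof (rule inj_onI)
    fix x y assume xy: "x \<in> parcs H" "y \<in> parcs H" "map_prod f f x = map_prod f f y"
    have "fst x = fst y" "snd x = snd y"
      using xy by (auto intro!: inj_onD[OF f(1)] simp: map_prod_def split: prod.splits
          dest: H.in_arcsD1 H.in_arcsD2)
    then show "x = y" by (rule prod_eqI)
  qed
  then have iso: "pre_digraph.digraph_isomorphism (with_proj H) h"
    using f(1) H.wf_digraph by (simp add: pre_digraph.digraph_isomorphism_def h_def)
  have "wf_digraph (app_iso h (with_proj H))"
    by unfold_locales (auto simp: h_def dest: H.in_arcsD1 H.in_arcsD2)
  then have "subgraph (app_iso h (with_proj H)) (with_proj G)"
    using f G.wf_digraph by (auto simp: subgraph_def compatible_def h_def)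
  with iso show "contains_graph G H"
    unfolding contains_graph_def digraph_iso_def by blast
qed

lemma pair_graph_cycle_graph:
  assumes "m \<ge> 2"
  shows "pair_graph (cycle_graph m)"
proof -
  have "finite (parcs (cycle_graph m))"
    by (rule finite_subset[of _ "{..<m} \<times> {..<m}"]) (auto simp: cycle_graph_def)
  moreover have "i \<noteq> Suc i mod m" "Suc i mod m \<noteq> i" if "i < m" for i
    using that assms by (auto simp: mod_Suc)
  ultimately show ?thesis
    by unfold_locales
      (auto simp: cycle_graph_def symmetric_def with_proj_def arcs_ends_conv sym_def image_iff)
qed

(* The maximum is taken over a finite nonempty set whenever n > 0 and H has an edge. *)
lemma regular_free_degrees_less:
  assumes "n > 0" "k \<in> regular_free_degrees n H"
  shows "k < n"
proof -
  obtain G :: "nat pair_pre_digraph"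
    where G: "pair_graph G" "card (pverts G) = n" "k_regular k G"
    using assms unfolding regular_free_degrees_def by auto
  interpret G: pair_graph G by (rule G)
  obtain v where v: "v \<in> pverts G" using G(2) assms(1) by fastforce
  have "out_arcs (with_proj G) v \<subseteq> Pair v ` (pverts G - {v})"
    using G.in_arcsD2 G.pair_no_loops by (fastforce simp: out_arcs_def)
  then have "out_degree (with_proj G) v \<le> card (pverts G - {v})"
    unfolding out_degree_def using G.pair_finite_verts
    by (meson card_image_le card_mono finite_Diff finite_imageI le_trans)
  also have "\<dots> < n" using v G(2) assms(1) by simp
  finally show ?thesis using G(3) v by (simp add: k_regular_def)
qed

lemma zero_in_regular_free_degrees:
  assumes "pair_wf_digraph H" "parcs H \<noteq> {}"
  shows "0 \<in> regular_free_degrees n H"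
proof -
  let ?G = "\<lparr> pverts = {..<n}, parcs = {} \<rparr> :: nat pair_pre_digraph"
  have G: "pair_graph ?G"
    by unfold_locales (auto simp: symmetric_def with_proj_def arcs_ends_conv sym_def)
  then interpret G: pair_graph ?G .
  have "\<not> contains_graph ?G H"
    using assms(2) by (auto simp: contains_graph_iff[OF G.pair_wf_digraph assms(1)])
  moreover have "k_regular 0 ?G"
    by (simp add: k_regular_def out_degree_def out_arcs_def with_proj_def)
  ultimately show ?thesis using G unfolding regular_free_degrees_def by fastforce
qed

end

theory Submission
  imports Defs
begin

text \<open>
  Upper bound. Let \<open>G\<close> be \<open>k\<close>-regular and connected but not bipartite, with \<open>(2l + 1) k > 2n\<close>
  (for odd \<open>n\<close>, take a component of odd order and use that \<open>k\<close> is even). Call an edge thick if it lies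
  in a complete bipartite subgraph with sides of size \<open>2l\<close>; by pigeonhole each vertex has only boundedly
  many thin edges. An odd cycle with a thick edge can be lengthened by two inside the complete
  bipartite subgraph, so it suffices to find one of length at most \<open>2l - 1\<close>. In a shortest odd cycle with
  a thick edge, two vertices with a common neighbour along thick edges are at distance two on the cycle.
  If the thick edges span an odd cycle, this leaves at most two neighbours on a shortest one to every
  vertex, and double counting bounds its length. If they span a bipartite graph, some pair
  at distance two has disjoint thick neighbourhoods; going around the cycle in steps of four from
  there yields more than half of the cycle with pairwise disjoint thick neighbourhoods. An odd cycle
  with a thick edge exists at all because a regular graph has no bipartite end block.

  Lower bound. For odd \<open>n\<close>, spread the vertices over an unbalanced blow-up of the cycle of length
  \<open>2l + 1\<close>, laying out the edges between consecutive parts cyclically so that degrees are equitable.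
\<close>

section \<open>Odd cycles and two-colourings\<close>

fun path_arcs :: "'a list \<Rightarrow> ('a \<times> 'a) set" where
  "path_arcs (x # y # zs) = insert (x, y) (path_arcs (y # zs))"
| "path_arcs _ = {}"

definition cycle_arcs :: "'a list \<Rightarrow> ('a \<times> 'a) set" where
  "cycle_arcs xs = path_arcs (xs @ [hd xs])"

text \<open>A one-element list qualifies exactly when \<open>E\<close> has a loop there, and the
  empty list is excluded by parity. For irreflexive \<open>E\<close> the length is therefore at
  least three.\<close>

definition odd_cycle :: "('a \<times> 'a) set \<Rightarrow> 'a list \<Rightarrow> bool" where
  "odd_cycle E xs \<longleftrightarrow> distinct xs \<and> odd (length xs) \<and> cycle_arcs xs \<subseteq> E"

text \<open>The index runs over all naturals, so that an arc of the cycle that passes its starting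
  point is still an interval \<open>[i..<j]\<close> of indices.\<close>

definition cyclic_seq :: "('a \<times> 'a) set \<Rightarrow> nat \<Rightarrow> (nat \<Rightarrow> 'a) \<Rightarrow> bool" where
  "cyclic_seq E M c \<longleftrightarrow> (\<forall>i j. c i = c j \<longleftrightarrow> i mod M = j mod M) \<and> (\<forall>i. (c i, c (Suc i)) \<in> E)"

definition two_colouring :: "('a \<times> 'a) set \<Rightarrow> ('a \<Rightarrow> bool) \<Rightarrow> bool" where
  "two_colouring E \<chi> \<longleftrightarrow> (\<forall>(u, v) \<in> E. \<chi> u \<noteq> \<chi> v)"

lemma path_arcs_append: "path_arcs (xs @ y # ys) = path_arcs (xs @ [y]) \<union> path_arcs (y # ys)"
  by (induction xs rule: path_arcs.induct) (auto split: list.splits)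

lemma path_arcs_Cons: "xs \<noteq> [] \<Longrightarrow> path_arcs (x # xs) = insert (x, hd xs) (path_arcs xs)"
  by (cases xs) auto

lemma path_arcs_snoc: "xs \<noteq> [] \<Longrightarrow> path_arcs (xs @ [y]) = insert (last xs, y) (path_arcs xs)"
  by (induction xs rule: path_arcs.induct) auto

lemma path_arcs_append2:
  "xs \<noteq> [] \<Longrightarrow> ys \<noteq> [] \<Longrightarrow>
    path_arcs (xs @ ys) = insert (last xs, hd ys) (path_arcs xs \<union> path_arcs ys)"
  by (induction xs rule: path_arcs.induct) (auto simp: path_arcs_Cons)

lemma path_arcs_rev: "path_arcs (rev xs) = (path_arcs xs)\<inverse>"
proof (induction xs rule: path_arcs.induct)
  case (1 x y zs)
  then show ?case using path_arcs_append[of "rev zs" y "[x]"] by auto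
qed auto

lemma path_arcs_conv_nth: "path_arcs xs = {(xs ! i, xs ! Suc i) | i. Suc i < length xs}"
proof (induction xs rule: path_arcs.induct)
  case (1 x y zs)
  have "{((x # y # zs) ! i, (x # y # zs) ! Suc i) | i. Suc i < length (x # y # zs)} =
    insert (x, y) {((y # zs) ! i, (y # zs) ! Suc i) | i. Suc i < length (y # zs)}"
    (is "?L = ?R")
  proof
    show "?L \<subseteq> ?R"
    proof
      fix p assume "p \<in> ?L"
      then obtain i where "p = ((x # y # zs) ! i, (x # y # zs) ! Suc i)" "Suc i < length (x # y # zs)"
        by blast
      then show "p \<in> ?R" by (cases i) auto
    qed
    show "?R \<subseteq> ?L"
    proof
      fix p assume "p \<in> ?R"
      then consider "p = (x, y)" | i where "p = ((y # zs) ! i, (y # zs) ! Suc i)" "Suc i < length (y # zs)"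
        by blast
      then show "p \<in> ?L"
      proof cases
        case 1 then show ?thesis by force
      next
        case 2 then show ?thesis by (intro CollectI exI[of _ "Suc i"]) auto
      qed
    qed
  qed
  with 1 show ?case by simp
qed auto

lemma path_arcs_map_upt:
  "path_arcs (map c [i..<j]) = (\<lambda>a. (c a, c (Suc a))) ` {a. i \<le> a \<and> Suc a < j}"
proof (induction "j - i" arbitrary: i)
  case (Suc d)
  then have *: "path_arcs (map c [Suc i..<j]) = (\<lambda>a. (c a, c (Suc a))) ` {a. Suc i \<le> a \<and> Suc a < j}"
    by simp
  have ij: "i < j" using Suc by simp
  show ?case
  proof (cases "Suc i < j")
    case True
    have "{a. i \<le> a \<and> Suc a < j} = insert i {a. Suc i \<le> a \<and> Suc a < j}" using True by auto
    then show ?thesis using * ij True by (simp add: upt_conv_Cons)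
  next
    case False
    then have "j = Suc i" using ij by simp
    then show ?thesis by simp
  qed
qed simp

lemma cycle_arcs_eq: "xs \<noteq> [] \<Longrightarrow> cycle_arcs xs = insert (last xs, hd xs) (path_arcs xs)"
  by (simp add: cycle_arcs_def path_arcs_snoc)

lemma cycle_arcs_conv_nth:
  assumes "xs \<noteq> []"
  shows "cycle_arcs xs = {(xs ! (i mod length xs), xs ! (Suc i mod length xs)) | i. True}"
proof -
  let ?M = "length xs"
  have "cycle_arcs xs = {((xs @ [hd xs]) ! i, (xs @ [hd xs]) ! Suc i) | i. i < ?M}"
    by (simp add: cycle_arcs_def path_arcs_conv_nth)
  also have "\<dots> = {(xs ! i, xs ! (Suc i mod ?M)) | i. i < ?M}"
  proof -
    have "(xs @ [hd xs]) ! i = xs ! i \<and> (xs @ [hd xs]) ! Suc i = xs ! (Suc i mod ?M)" if "i < ?M" for i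
    proof (cases "Suc i = ?M")
      case True
      then show ?thesis using assms by (auto simp: nth_append hd_conv_nth)
    next
      case False
      then show ?thesis using that by (auto simp: nth_append)
    qed
    then show ?thesis by force
  qed
  also have "\<dots> = {(xs ! (i mod ?M), xs ! (Suc i mod ?M)) | i. True}"
  proof
    show "{(xs ! i, xs ! (Suc i mod ?M)) | i. i < ?M} \<subseteq> {(xs ! (i mod ?M), xs ! (Suc i mod ?M)) | i. True}"
      by (smt (verit) Collect_mono mod_less)
    show "{(xs ! (i mod ?M), xs ! (Suc i mod ?M)) | i. True} \<subseteq> {(xs ! i, xs ! (Suc i mod ?M)) | i. i < ?M}"
    proof
      fix p assume "p \<in> {(xs ! (i mod ?M), xs ! (Suc i mod ?M)) | i. True}"
      then obtain i where "p = (xs ! (i mod ?M), xs ! (Suc i mod ?M))" by blast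
      then show "p \<in> {(xs ! i, xs ! (Suc i mod ?M)) | i. i < ?M}"
        using assms by (intro CollectI exI[of _ "i mod ?M"]) (auto simp: mod_Suc_eq)
    qed
  qed
  finally show ?thesis .
qed

section \<open>Cycles as periodic sequences\<close>

lemma odd_cycle_seq:
  assumes "distinct xs" "xs \<noteq> []" "cycle_arcs xs \<subseteq> E"
  defines "c \<equiv> \<lambda>i. xs ! (i mod length xs)"
  shows "cyclic_seq E (length xs) c" "range c = set xs"
    "cycle_arcs xs = range (\<lambda>i. (c i, c (Suc i)))"
proof -
  have [simp]: "i mod length xs < length xs" for i using assms(2) by simp
  show 3: "cycle_arcs xs = range (\<lambda>i. (c i, c (Suc i)))"
    using cycle_arcs_conv_nth[OF assms(2)] by (auto simp: c_def)
  show "cyclic_seq E (length xs) c"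
    using 3 assms(3) assms(1) by (auto simp: cyclic_seq_def c_def nth_eq_iff_index_eq)
  show "range c = set xs"
  proof
    show "range c \<subseteq> set xs" by (auto simp: c_def)
    show "set xs \<subseteq> range c"
      by (auto simp: c_def in_set_conv_nth) (metis mod_less rangeI)
  qed
qed

lemma mod_eq_window:
  fixes a b i M :: nat
  assumes "i \<le> a" "a < i + M" "i \<le> b" "b < i + M"
  shows "a mod M = b mod M \<longleftrightarrow> a = b"
proof -
  have *: "a = b" if "a mod M = b mod M" "a \<le> b" "b < a + M" for a b :: nat
  proof -
    have "M dvd b - a" using that mod_eq_dvd_iff_nat[of a b M] by simp
    moreover have "b - a < M" using that by linarith
    ultimately have "b - a = 0" by (meson dvd_imp_le not_le not_gr_zero)
    then show ?thesis using that by simp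
  qed
  show ?thesis
  proof (cases "a \<le> b")
    case True
    then show ?thesis using *[of a b] assms by auto
  next
    case False
    then show ?thesis using *[of b a] assms by auto
  qed
qed

lemma cyclic_seq_distinct:
  assumes "cyclic_seq E M c" "j \<le> i + M"
  shows "distinct (map c [i..<j])"
  using assms by (auto simp: distinct_map cyclic_seq_def inj_on_def mod_eq_window[of i _ M])

lemma cyclic_seq_add: "cyclic_seq E M c \<Longrightarrow> c (i + M) = c i"
  by (simp add: cyclic_seq_def)

lemma cyclic_seq_cycle:
  assumes "cyclic_seq E M c" "M > 0"
  shows "cycle_arcs (map c [i..<i + M]) = range (\<lambda>a. (c a, c (Suc a)))"
    "set (map c [i..<i + M]) = range c"
proof -
  have per: "\<exists>b. i \<le> b \<and> b < i + M \<and> b mod M = a mod M" for a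
  proof -
    \<comment> \<open>\<open>M * i - i\<close> is a natural number congruent to \<open>- i\<close>
      modulo \<open>M\<close>, so this is the representative of \<open>a\<close> in the window that
      starts at \<open>i\<close>.\<close>
    have "i + (a + (M * i - i)) mod M < i + M" using assms(2) by simp
    moreover have "(i + (a + (M * i - i)) mod M) mod M = a mod M"
    proof -
      have "(i + (a + (M * i - i)) mod M) mod M = (i + (a + (M * i - i))) mod M" by (simp add: mod_add_right_eq)
      also have "i + (a + (M * i - i)) = a + M * i" using assms(2) by (cases M) auto
      finally show ?thesis by simp
    qed
    ultimately show ?thesis by (intro exI[of _ "i + (a + (M * i - i)) mod M"]) auto
  qed
  have eq: "c a = c b" "c (Suc a) = c (Suc b)" if "a mod M = b mod M" for a b
    using that assms(1) mod_Suc_eq[of a M] mod_Suc_eq[of b M] by (auto simp: cyclic_seq_def)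
  show "set (map c [i..<i + M]) = range c"
  proof
    show "range c \<subseteq> set (map c [i..<i + M])"
    proof
      fix v assume "v \<in> range c"
      then obtain a where a: "v = c a" by blast
      obtain b where "i \<le> b" "b < i + M" "b mod M = a mod M" using per by blast
      then show "v \<in> set (map c [i..<i + M])" using a eq(1)[of b a] by (auto intro: image_eqI[of _ c b])
    qed
  qed auto
  have "cycle_arcs (map c [i..<i + M]) = path_arcs (map c [i..<Suc (i + M)])"
    using assms by (simp add: cycle_arcs_def hd_map cyclic_seq_add)
  also have "\<dots> = (\<lambda>a. (c a, c (Suc a))) ` {a. i \<le> a \<and> Suc a < Suc (i + M)}"
    by (rule path_arcs_map_upt)
  also have "\<dots> = range (\<lambda>a. (c a, c (Suc a)))"
  proof (intro equalityI subsetI)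
    fix p assume "p \<in> range (\<lambda>a. (c a, c (Suc a)))"
    then obtain a where a: "p = (c a, c (Suc a))" by blast
    obtain b where "i \<le> b" "b < i + M" "b mod M = a mod M" using per by blast
    then show "p \<in> (\<lambda>a. (c a, c (Suc a))) ` {a. i \<le> a \<and> Suc a < Suc (i + M)}"
      using a eq[of b a] by (auto simp: image_iff)
  qed auto
  finally show "cycle_arcs (map c [i..<i + M]) = range (\<lambda>a. (c a, c (Suc a)))" .
qed

section \<open>Bipartiteness and odd cycles\<close>

text \<open>Colour each vertex by the parity of a chosen walk from a root of its component. An arc
  with equally coloured ends joins the two walks to an odd closed walk.\<close>

lemma two_coloured_or_odd_closed_walk:
  assumes "sym E"
  shows "(\<exists>\<chi>. two_colouring E \<chi>) \<or> (\<exists>xs. odd (length xs) \<and> cycle_arcs xs \<subseteq> E)"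
proof -
  define walk where "walk u v xs \<longleftrightarrow> xs \<noteq> [] \<and> hd xs = u \<and> last xs = v \<and> path_arcs xs \<subseteq> E" for u v xs
  define conn where "conn u v \<longleftrightarrow> (\<exists>xs. walk u v xs)" for u v
  define root where "root v = (SOME u. conn u v)" for v
  define path where "path v = (SOME xs. walk (root v) v xs)" for v
  have conn_root: "conn (root v) v" for v
  proof -
    have "walk v v [v]" by (simp add: walk_def)
    then have "conn v v" unfolding conn_def by blast
    then show ?thesis unfolding root_def by (rule someI)
  qed
  have path: "walk (root v) v (path v)" for v
    using someI_ex[OF conn_root[of v, unfolded conn_def]] by (simp add: path_def)
  have step: "conn u w" if "conn u v" "(v, w) \<in> E" for u v w
  proof -
    obtain xs where "walk u v xs" using \<open>conn u v\<close> unfolding conn_def by blast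
    then have "walk u w (xs @ [w])" using that by (simp add: walk_def path_arcs_snoc)
    then show ?thesis unfolding conn_def by blast
  qed
  \<comment> \<open>Both roots are chosen from the same predicate and hence coincide, so the two
    walks start at the same vertex.\<close>
  have root_eq: "root v = root w" if "(v, w) \<in> E" for v w
  proof -
    have "conn u v = conn u w" for u using step that assms by (meson symD)
    then show ?thesis unfolding root_def by simp
  qed
  show ?thesis
  proof (cases "two_colouring E (\<lambda>v. even (length (path v)))")
    case False
    then obtain v w where vw: "(v, w) \<in> E" "even (length (path v)) = even (length (path w))"
      by (auto simp: two_colouring_def)
    define xs where "xs = path v"
    define ys where "ys = path w"
    have xs: "xs \<noteq> []" "hd xs = root v" "last xs = v" "path_arcs xs \<subseteq> E"
      using path[of v] by (auto simp: xs_def walk_def)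
    have ys: "ys \<noteq> []" "hd ys = root v" "last ys = w" "path_arcs ys \<subseteq> E"
      using path[of w] root_eq[OF vw(1)] by (auto simp: ys_def walk_def)
    obtain zs where zs: "ys = root v # zs" using ys(1,2) by (cases ys) auto
    \<comment> \<open>The root is dropped from \<open>ys\<close> because the closing arc returns to
      it as the head of \<open>xs\<close>; this makes the total length odd.\<close>
    have "cycle_arcs (xs @ rev zs) = path_arcs (xs @ rev ys)"
      using xs zs by (simp add: cycle_arcs_def)
    also have "\<dots> \<subseteq> E"
    proof -
      have "path_arcs (rev ys) \<subseteq> E" using ys(4) assms by (auto simp: path_arcs_rev dest: symD)
      then show ?thesis using xs ys vw(1) by (auto simp: path_arcs_append2 hd_rev)
    qed
    finally have "cycle_arcs (xs @ rev zs) \<subseteq> E" .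
    moreover have "odd (length (xs @ rev zs))" using vw(2) zs by (auto simp: xs_def ys_def)
    ultimately show ?thesis by blast
  qed blast
qed

text \<open>A repeated vertex splits the walk into two shorter closed walks whose lengths add up to
  the old one, so one of them is odd again.\<close>

lemma odd_closed_walk_imp_odd_cycle:
  assumes "odd (length xs)" "cycle_arcs xs \<subseteq> E"
  shows "\<exists>ys. odd_cycle E ys"
  using assms
proof (induction "length xs" arbitrary: xs rule: less_induct)
  case less
  show ?case
  proof (cases "distinct xs")
    case True
    then show ?thesis using less.prems by (auto simp: odd_cycle_def)
  next
    case False
    then obtain as y bs cs where xs: "xs = as @ [y] @ bs @ [y] @ cs" using not_distinct_decomp by blast
    \<comment> \<open>If \<open>as\<close> is empty the walk starts at \<open>y\<close> itself;
      \<open>?h\<close> covers both cases.\<close>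
    let ?h = "hd (as @ [y])"
    have h: "hd xs = ?h" "hd (as @ y # cs) = ?h" unfolding xs by (cases as; simp)+
    have "cycle_arcs xs = path_arcs (as @ y # (bs @ y # (cs @ [?h])))"
      by (simp add: cycle_arcs_def h) (simp add: xs)
    also have "\<dots> = path_arcs (as @ [y]) \<union> path_arcs ((y # bs) @ y # (cs @ [?h]))"
      by (subst path_arcs_append) simp
    also have "\<dots> = path_arcs (as @ [y]) \<union> path_arcs ((y # bs) @ [y]) \<union> path_arcs (y # cs @ [?h])"
      by (subst path_arcs_append) (simp add: Un_assoc)
    finally have sub: "path_arcs (as @ [y]) \<subseteq> E" "path_arcs ((y # bs) @ [y]) \<subseteq> E"
      "path_arcs (y # cs @ [?h]) \<subseteq> E"
      using less.prems(2) by auto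
    have 1: "cycle_arcs (y # bs) \<subseteq> E" using sub(2) by (simp add: cycle_arcs_def)
    have "cycle_arcs (as @ y # cs) = path_arcs (as @ y # (cs @ [?h]))" by (simp add: cycle_arcs_def h)
    also have "\<dots> = path_arcs (as @ [y]) \<union> path_arcs (y # cs @ [?h])" by (rule path_arcs_append)
    finally have 2: "cycle_arcs (as @ y # cs) \<subseteq> E" using sub by simp
    have "odd (length (y # bs)) \<or> odd (length (as @ y # cs))" using less.prems(1) by (auto simp: xs)
    then show ?thesis using less.hyps[of "y # bs"] less.hyps[of "as @ y # cs"] 1 2 by (auto simp: xs)
  qed
qed

lemma two_colouring_or_odd_cycle:
  "sym E \<Longrightarrow> (\<exists>\<chi>. two_colouring E \<chi>) \<or> (\<exists>xs. odd_cycle E xs)"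
  using two_coloured_or_odd_closed_walk odd_closed_walk_imp_odd_cycle by metis

lemma odd_cycle_nonempty: "odd_cycle E xs \<Longrightarrow> xs \<noteq> []"
  by (auto simp: odd_cycle_def)

section \<open>Shortest odd cycles: chords and common neighbours\<close>

text \<open>The chord closes the arc with an even number of edges to an odd cycle. By minimality
  that arc has \<open>M - 1\<close> edges, hence the other has one. The cycle lives in
  \<open>D\<close> and the chord in \<open>R\<close>, because the later counts need the pairs
  \<open>(T, T)\<close>, \<open>(T, E)\<close> and \<open>(E, T)\<close>.\<close>

lemma chord_joins_consecutive:
  assumes c: "cyclic_seq D M c" and "odd M"
    and min: "\<And>xs. odd_cycle (D \<union> R) xs \<Longrightarrow> cycle_arcs xs \<inter> D \<noteq> {} \<Longrightarrow>
      cycle_arcs xs \<inter> R \<noteq> {} \<Longrightarrow> M \<le> length xs"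
    and R: "sym R" "(c h, c i) \<in> R" and hi: "h < i" "i < h + M"
  shows "i = h + 1 \<or> i + 1 = h + M"
proof -
  have *: "b + 1 = a + M" if "(c b, c a) \<in> R" "a < b" "b < a + M" "even (b - a)" for a b
  proof -
    let ?xs = "map c [a..<Suc b]"
    have ca: "cycle_arcs ?xs = insert (c b, c a) (path_arcs ?xs)"
      using that by (subst cycle_arcs_eq) (auto simp: hd_map last_map hd_upt)
    have pa: "path_arcs ?xs = (\<lambda>i. (c i, c (Suc i))) ` {i. a \<le> i \<and> Suc i < Suc b}"
      by (rule path_arcs_map_upt)
    have D: "path_arcs ?xs \<subseteq> D" using c unfolding pa by (auto simp: cyclic_seq_def)
    have "path_arcs ?xs \<noteq> {}" using that unfolding pa by auto
    then have "M \<le> length ?xs"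
      using that D c cyclic_seq_distinct[OF c, of "Suc b" a]
      by (intro min) (auto simp: odd_cycle_def ca simp del: upt_Suc)
    then show ?thesis using that by simp
  qed
  show ?thesis
  proof (cases "even (i - h)")
    case True
    then show ?thesis using *[of i h] R hi by (auto dest: symD)
  next
    case False
    have "c (h + M) = c h" using c by (rule cyclic_seq_add)
    moreover have "even (h + M - i)" using False \<open>odd M\<close> hi by presburger
    ultimately show ?thesis using *[of "h + M" i] R hi by auto
  qed
qed

text \<open>The vertex \<open>w\<close> closes the arc from \<open>c i\<close> to \<open>c j\<close>
  to an odd cycle of length \<open>j - i + 2\<close>.\<close>

lemma ear_long_arc:
  assumes c: "cyclic_seq D M c"
    and min: "\<And>xs. odd_cycle (D \<union> R) xs \<Longrightarrow> cycle_arcs xs \<inter> D \<noteq> {} \<Longrightarrow>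
      cycle_arcs xs \<inter> R \<noteq> {} \<Longrightarrow> M \<le> length xs"
    and R: "sym R" "(w, c i) \<in> R" "(w, c j) \<in> R" and w: "w \<notin> range c"
    and ij: "i < j" "j < i + M" "odd (j - i)"
  shows "M \<le> j - i + 2"
proof -
  let ?xs = "map c [i..<Suc j]"
  have ca: "cycle_arcs (w # ?xs) = insert (c j, w) (insert (w, c i) (path_arcs ?xs))"
    using ij by (subst cycle_arcs_eq) (auto simp: path_arcs_Cons last_map hd_map)
  have pa: "path_arcs ?xs = (\<lambda>i. (c i, c (Suc i))) ` {a. i \<le> a \<and> Suc a < Suc j}"
    by (rule path_arcs_map_upt)
  have D: "path_arcs ?xs \<subseteq> D" using c unfolding pa by (auto simp: cyclic_seq_def)
  have "path_arcs ?xs \<noteq> {}" using ij unfolding pa by auto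
  moreover have "(c j, w) \<in> R" using R by (auto dest: symD)
  ultimately have "M \<le> length (w # ?xs)"
    using ij D R w cyclic_seq_distinct[OF c, of "Suc j" i]
    by (intro min) (auto simp: odd_cycle_def ca simp del: upt_Suc)
  then show ?thesis using ij by simp
qed

text \<open>If \<open>w\<close> lies on the cycle, both vertices are next to it there, because
  chords join consecutive vertices. Otherwise the odd one of the two arcs between them has at least
  \<open>M - 2\<close> edges, which leaves at most two for the other, even one.\<close>

lemma common_neighbour_distance_two:
  assumes c: "cyclic_seq D M c" and M: "odd M"
    and min: "\<And>xs. odd_cycle (D \<union> R) xs \<Longrightarrow> cycle_arcs xs \<inter> D \<noteq> {} \<Longrightarrow>
      cycle_arcs xs \<inter> R \<noteq> {} \<Longrightarrow> M \<le> length xs"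
    and R: "sym R" "irrefl R" "(w, c i) \<in> R" "(w, c j) \<in> R"
    and ij: "i < M" "j < M" "i \<noteq> j"
  shows "(i + 2) mod M = j \<or> (j + 2) mod M = i"
proof (cases "w \<in> range c")
  case True
  then obtain h' where "w = c h'" by blast
  define h where "h = h' mod M"
  have h: "w = c h" "h < M" using c \<open>w = c h'\<close> M by (auto simp: cyclic_seq_def h_def odd_pos)
  have near: "Suc h mod M = a \<or> Suc a mod M = h" if a: "a < M" "(w, c a) \<in> R" for a
  proof -
    have "a \<noteq> h" using a h R(2) by (auto simp: irrefl_def)
    then consider "h < a" | "a < h" by linarith
    then show ?thesis
    proof cases
      case 1
      have "a = h + 1 \<or> a + 1 = h + M"
        using 1 a h by (intro chord_joins_consecutive[OF c M min R(1)]) auto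
      then show ?thesis using a h by auto
    next
      case 2
      have "h = a + 1 \<or> h + 1 = a + M"
        using 2 a h R(1) by (intro chord_joins_consecutive[OF c M min R(1)]) (auto dest: symD)
      then show ?thesis using a h by auto
    qed
  qed
  have 1: "Suc (Suc a mod M) mod M = (a + 2) mod M" for a by (simp add: mod_Suc_eq)
  have 2: "i = j" if "Suc i mod M = Suc j mod M"
    using that ij by (auto simp: mod_Suc split: if_splits)
  show ?thesis using near[OF ij(1) R(3)] near[OF ij(2) R(4)] 1[of i] 1[of j] 2 ij(3) by auto
next
  case False
  have *: "(a + 2) mod M = b \<or> (b + 2) mod M = a"
    if ab: "a < b" "b < M" "(w, c a) \<in> R" "(w, c b) \<in> R" for a b
  proof (cases "odd (b - a)")
    case True
    have "M \<le> b - a + 2" using ab True False by (intro ear_long_arc[OF c min R(1)]) auto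
    \<comment> \<open>As \<open>M - 1\<close> is even, the odd arc has exactly \<open>M - 2\<close>
      edges.\<close>
    moreover have "b - a \<noteq> M - 1" using True M by presburger
    ultimately have "b + 2 = a + M" using ab by linarith
    then show ?thesis using ab by simp
  next
    case even: False
    have "c (a + M) = c a" using c by (rule cyclic_seq_add)
    then have "M \<le> a + M - b + 2" using ab even False M
      by (intro ear_long_arc[OF c min R(1)]) auto
    moreover have "b - a \<noteq> 1" using even by presburger
    ultimately have "b = a + 2" using ab by linarith
    then show ?thesis using ab by simp
  qed
  show ?thesis using *[of i j] *[of j i] ij R by (meson linorder_neqE_nat)
qed

text \<open>For three indices the cyclic differences would each be 2 or -2 modulo \<open>M\<close>
  and sum to 0, so \<open>M\<close> would divide 2 or 6.\<close>

lemma card_le_two_of_distance_two: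
  fixes M :: nat
  assumes "7 \<le> M" "S \<subseteq> {..<M}"
    and S: "\<And>i j. i \<in> S \<Longrightarrow> j \<in> S \<Longrightarrow> i \<noteq> j \<Longrightarrow> (i + 2) mod M = j \<or> (j + 2) mod M = i"
  shows "card S \<le> 2"
proof (rule ccontr)
  assume "\<not> card S \<le> 2"
  then obtain S' where S': "S' \<subseteq> S" "card S' = 3"
    using obtain_subset_with_card_n[of 3 S] by auto
  then obtain x y z where xyz: "S' = {x, y, z}" "x \<noteq> y" "x \<noteq> z" "y \<noteq> z"
    by (auto simp: card_3_iff)
  have lt: "x < M" "y < M" "z < M" using S' xyz assms(2) by auto
  have *: "b = a + 2 \<or> a = b + 2 \<or> b + M = a + 2 \<or> a + M = b + 2"
    if "(a + 2) mod M = b \<or> (b + 2) mod M = a" "a < M" "b < M" for a b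
  proof -
    have "(d + 2) mod M = d + 2 \<or> (d + 2) mod M + M = d + 2" if "d < M" for d
      using that assms(1) by (cases "d + 2 < M") (auto simp: mod_if)
    then show ?thesis using that by metis
  qed
  show False
    using *[OF S[of x y]] *[OF S[of x z]] *[OF S[of y z]] S' xyz lt assms(1) by auto
qed

text \<open>Double counting of the pairs of an index \<open>i\<close> and a vertex \<open>w\<close>
  with \<open>(w, c i)\<close> in \<open>R\<close>.\<close>

lemma card_image_relation_le:
  assumes fin: "finite V" and R: "sym R" "R \<subseteq> V \<times> V"
    and deg: "\<And>i. i < M \<Longrightarrow> d \<le> card (R `` {c i})"
    and few: "\<And>w. w \<in> V \<Longrightarrow> card {i \<in> {..<M}. (w, c i) \<in> R} \<le> b"
  shows "M * d \<le> b * card V"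
proof -
  have eq: "R `` {c i} = {w \<in> V. (w, c i) \<in> R}" for i using R by (auto dest: symD)
  have "M * d = (\<Sum>i<M. d)" by simp
  also have "\<dots> \<le> (\<Sum>i<M. card {w \<in> V. (w, c i) \<in> R})" using deg by (intro sum_mono) (simp add: eq)
  also have "\<dots> = (\<Sum>w\<in>V. card {i \<in> {..<M}. (w, c i) \<in> R})"
    using fin by (intro sum_multicount_gen) auto
  also have "\<dots> \<le> (\<Sum>w\<in>V. b)" using few by (intro sum_mono) auto
  finally show ?thesis by (simp add: mult.commute)
qed

section \<open>Thick edges\<close>

text \<open>For irreflexive \<open>E\<close> the sides are disjoint by
  \<open>P \<times> Q \<subseteq> E\<close>. For positive \<open>t\<close> they are finite, since
  infinite sets have cardinality 0.\<close>

definition thick :: "nat \<Rightarrow> ('a \<times> 'a) set \<Rightarrow> ('a \<times> 'a) set" where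
  "thick t E = {(a, b). \<exists>P Q. a \<in> P \<and> b \<in> Q \<and> t \<le> card P \<and> t \<le> card Q \<and> P \<times> Q \<subseteq> E}"

lemma thick_subset: "thick t E \<subseteq> E"
  by (auto simp: thick_def)

lemma sym_thick: "sym E \<Longrightarrow> sym (thick t E)"
proof (rule symI)
  fix a b assume "sym E" "(a, b) \<in> thick t E"
  then obtain P Q where PQ: "a \<in> P" "b \<in> Q" "t \<le> card P" "t \<le> card Q" "P \<times> Q \<subseteq> E"
    by (auto simp: thick_def)
  then have "Q \<times> P \<subseteq> E" using \<open>sym E\<close> by (auto dest: symD)
  then show "(b, a) \<in> thick t E" using PQ unfolding thick_def by blast
qed

text \<open>Let \<open>X\<close> consist of \<open>m\<close> thin neighbours of \<open>v\<close>.
  Vertices with fewer than \<open>t\<close> neighbours in \<open>X\<close> receive less than half of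
  the \<open>m * k\<close> arcs from \<open>X\<close>, so more than \<open>k / 2\<close> vertices
  have at least \<open>t\<close>. By pigeonhole over the subsets of \<open>X\<close>, at least
  \<open>t\<close> of them share the same \<open>t\<close> neighbours, which makes some edges from
  \<open>v\<close> to \<open>X\<close> thick.\<close>

lemma few_thin_neighbours:
  fixes E :: "('a \<times> 'a) set"
  assumes V: "finite V" "E \<subseteq> V \<times> V" and E: "sym E"
    and reg: "\<And>v. v \<in> V \<Longrightarrow> card (E `` {v}) = k"
    and dense: "2 * card V < L * k" and t: "0 < t" and large: "2 ^ (t * L + 1) * t \<le> k"
  shows "card (E `` {v} - thick t E `` {v}) < t * L"
proof (rule ccontr)
  define m where "m = t * L"
  assume "\<not> ?thesis"
  then obtain X where X: "X \<subseteq> E `` {v} - thick t E `` {v}" "card X = m"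
    using obtain_subset_with_card_n[of m "E `` {v} - thick t E `` {v}"] by (auto simp: m_def)
  have XV: "X \<subseteq> V" using X(1) V(2) by auto
  have finX: "finite X" using XV V(1) finite_subset by blast
  define G where "G = {w \<in> V. t \<le> card {x \<in> X. (x, w) \<in> E}}"
  have finG: "finite G" using V(1) by (simp add: G_def)
  have "m * k = (\<Sum>x\<in>X. card (E `` {x}))" using reg XV X(2) by (simp add: subset_iff)
  also have "\<dots> = (\<Sum>x\<in>X. card {w \<in> V. (x, w) \<in> E})"
    using V(2) by (intro sum.cong arg_cong[where f = card]) auto
  also have "\<dots> = (\<Sum>w\<in>V. card {x \<in> X. (x, w) \<in> E})"
    using finX V(1) by (intro sum_multicount_gen) auto
  also have "\<dots> \<le> (\<Sum>w\<in>V. (if w \<in> G then m else 0) + t)"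
  proof (rule sum_mono)
    fix w assume "w \<in> V"
    have "card {x \<in> X. (x, w) \<in> E} \<le> m" using finX X(2) by (metis (no_types, lifting) card_mono mem_Collect_eq subsetI)
    then show "card {x \<in> X. (x, w) \<in> E} \<le> (if w \<in> G then m else 0) + t"
      using \<open>w \<in> V\<close> by (auto simp: G_def)
  qed
  also have "\<dots> = card G * m + card V * t"
  proof -
    have "(\<Sum>w\<in>V. if w \<in> G then m else 0) = card G * m"
      using V(1) by (subst sum.inter_restrict[symmetric]) (auto simp: G_def Int_def)
    then show ?thesis by (simp add: sum.distrib)
  qed
  finally have "m * k \<le> card G * m + card V * t" .
  \<comment> \<open>The density hypothesis times \<open>t\<close>: the factor \<open>L\<close> in
    \<open>m\<close> is there so that the vertices outside \<open>G\<close> account for less than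
    half of the arcs.\<close>
  moreover have "2 * (card V * t) < m * k"
    using mult_strict_right_mono[OF dense t] by (simp add: m_def algebra_simps)
  ultimately have "m * k < 2 * (card G * m)" by linarith
  then have "m * k < m * (2 * card G)" by (simp only: ac_simps)
  then have big: "k < 2 * card G" by (metis mult_less_cancel1)
  have "\<exists>Y. Y \<subseteq> {x \<in> X. (x, w) \<in> E} \<and> card Y = t" if "w \<in> G" for w
    using that obtain_subset_with_card_n unfolding G_def by (metis (lifting) mem_Collect_eq)
  then obtain \<phi> where \<phi>: "\<And>w. w \<in> G \<Longrightarrow> \<phi> w \<subseteq> {x \<in> X. (x, w) \<in> E} \<and> card (\<phi> w) = t"
    by metis
  have "\<exists>Y \<in> Pow X. t \<le> card {w \<in> G. \<phi> w = Y}"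
  proof (rule ccontr)
    assume "\<not> ?thesis"
    then have "\<forall>Y \<in> Pow X. card {w \<in> G. \<phi> w = Y} < t" by (simp only: not_le bex_simps(8))
    then have small: "card {w \<in> G. \<phi> w = Y} \<le> t" if "Y \<in> Pow X" for Y
      using that less_imp_le by blast
    have "G = (\<Union>Y\<in>Pow X. {w \<in> G. \<phi> w = Y})" using \<phi> by blast
    then have "card G \<le> (\<Sum>Y\<in>Pow X. card {w \<in> G. \<phi> w = Y})"
      using finX card_UN_le[of "Pow X" "\<lambda>Y. {w \<in> G. \<phi> w = Y}"] by simp
    also have "\<dots> \<le> (\<Sum>Y\<in>Pow X. t)" using small by (intro sum_mono) auto
    also have "\<dots> = 2 ^ m * t" using finX X(2) by (simp add: card_Pow)
    finally have "2 * card G \<le> 2 ^ (m + 1) * t" by simp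
    then show False using big large by (simp add: m_def)
  qed
  then obtain Y where Y: "Y \<subseteq> X" "t \<le> card {w \<in> G. \<phi> w = Y}" by blast
  define W where "W = {w \<in> G. \<phi> w = Y}"
  have "W \<noteq> {}" using Y(2) t unfolding W_def by force
  then have cY: "card Y = t" using \<phi> by (auto simp: W_def)
  then obtain y where y: "y \<in> Y" using t by fastforce
  \<comment> \<open>\<open>Y\<close> consists of neighbours of \<open>v\<close>, so \<open>v\<close>
    can join the side \<open>W\<close>.\<close>
  have "insert v W \<times> Y \<subseteq> E"
  proof (rule subsetI)
    fix p assume "p \<in> insert v W \<times> Y"
    then consider "p \<in> {v} \<times> Y" | "p \<in> W \<times> Y" by blast
    then show "p \<in> E"
    proof cases
      case 1
      then show ?thesis using Y(1) X(1) by auto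
    next
      case 2
      then obtain u y where "p = (u, y)" "u \<in> G" "y \<in> \<phi> u" by (auto simp: W_def)
      then show ?thesis using \<phi>[of u] E by (auto dest: symD)
    qed
  qed
  moreover have "t \<le> card (insert v W)"
    using Y(2) finG card_insert_le[of W v] unfolding W_def by linarith
  ultimately have "(v, y) \<in> thick t E" using y cY unfolding thick_def by blast
  then show False using y Y(1) X(1) by auto
qed

section \<open>Lengthening a cycle at a thick edge\<close>

text \<open>The thick edge is replaced by a path of three edges inside its complete bipartite
  subgraph; fresh inner vertices exist because the cycle has fewer than \<open>t\<close>
  vertices.\<close>

lemma extend_thick_cycle:
  assumes E: "sym E" "irrefl E" and xs: "odd_cycle E xs" "cycle_arcs xs \<inter> thick t E \<noteq> {}"
    and t: "length xs < t"
  shows "\<exists>ys. odd_cycle E ys \<and> cycle_arcs ys \<inter> thick t E \<noteq> {} \<and> length ys = length xs + 2"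
proof -
  define M where "M = length xs"
  have ne: "xs \<noteq> []" using odd_cycle_nonempty[OF xs(1)] .
  define c where "c = (\<lambda>i. xs ! (i mod length xs))"
  have c: "cyclic_seq E M c" "range c = set xs" "cycle_arcs xs = range (\<lambda>i. (c i, c (Suc i)))"
    using odd_cycle_seq[OF _ ne, of E] xs(1) by (auto simp: odd_cycle_def M_def c_def)
  obtain a where a: "(c a, c (Suc a)) \<in> thick t E" using xs(2) c(3) by auto
  then obtain P Q where PQ: "c a \<in> P" "c (Suc a) \<in> Q" "t \<le> card P" "t \<le> card Q" "P \<times> Q \<subseteq> E"
    by (auto simp: thick_def)
  have new: "\<exists>p \<in> P. p \<notin> set xs" if "t \<le> card P" for P
  proof (rule ccontr)
    assume "\<not> ?thesis"
    then have "card P \<le> card (set xs)" by (intro card_mono) auto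
    then show False using that t card_length[of xs] by linarith
  qed
  obtain p q where p: "p \<in> P" "p \<notin> set xs" and q: "q \<in> Q" "q \<notin> set xs" using new PQ by meson
  have pq: "p \<noteq> q" using p q PQ(5) E(2) by (auto simp: irrefl_def)
  \<comment> \<open>The cycle is started right after the thick edge, which thus becomes its closing
    arc.\<close>
  let ?zs = "map c [Suc a..<Suc a + M]"
  have M0: "M > 0" using ne M_def by simp
  have last: "last ?zs = c a"
    using M0 cyclic_seq_add[OF c(1), of a] by (simp add: last_map)
  have hd: "hd ?zs = c (Suc a)" using M0 by (simp add: hd_map del: upt_Suc)
  have zne: "?zs \<noteq> []" using M0 by simp
  have ca: "cycle_arcs (?zs @ [q, p]) = {(p, c (Suc a)), (c a, q), (q, p)} \<union> path_arcs ?zs"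
    using zne last hd by (auto simp: cycle_arcs_eq path_arcs_append2 simp del: upt_Suc)
  have "path_arcs ?zs \<subseteq> E"
    using cyclic_seq_cycle(1)[OF c(1) M0, of "Suc a"] zne c(3) xs(1)
    by (auto simp: cycle_arcs_eq odd_cycle_def simp del: upt_Suc)
  then have arcs: "cycle_arcs (?zs @ [q, p]) \<subseteq> E"
    using ca p q PQ E(1) by (auto dest: symD)
  have dist: "distinct (?zs @ [q, p])"
    using cyclic_seq_distinct[OF c(1), of "Suc a + M" "Suc a"] cyclic_seq_cycle(2)[OF c(1) M0, of "Suc a"]
      c(2) p q pq by (auto simp del: upt_Suc)
  \<comment> \<open>The same \<open>P\<close> and \<open>Q\<close> witness that a new edge is thick,
    so the step can be repeated.\<close>
  have "(c a, q) \<in> thick t E" using PQ q unfolding thick_def by blast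
  then have "cycle_arcs (?zs @ [q, p]) \<inter> thick t E \<noteq> {}" using ca by auto
  moreover have "odd_cycle E (?zs @ [q, p])"
    using arcs dist xs(1) by (auto simp: odd_cycle_def M_def simp del: upt_Suc)
  moreover have "length (?zs @ [q, p]) = length xs + 2" by (simp add: M_def del: upt_Suc)
  ultimately show ?thesis by blast
qed

lemma extend_thick_cycle_to:
  assumes E: "sym E" "irrefl E" and xs: "odd_cycle E xs" "cycle_arcs xs \<inter> thick t E \<noteq> {}"
    and N: "length xs \<le> N" "odd N" "N \<le> t"
  shows "\<exists>ys. odd_cycle E ys \<and> length ys = N"
  using xs N(1)
proof (induction "N - length xs" arbitrary: xs rule: less_induct)
  case less
  show ?case
  proof (cases "length xs = N")
    case True
    then show ?thesis using less.prems by blast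
  next
    case False
    then obtain ys where ys: "odd_cycle E ys" "cycle_arcs ys \<inter> thick t E \<noteq> {}" "length ys = length xs + 2"
      using extend_thick_cycle[OF E less.prems(1,2)] less.prems(3) N(3) by auto
    have "odd (length xs)" using less.prems(1) by (simp add: odd_cycle_def)
    then have "length xs + 2 \<le> N" using False less.prems(3) N(2) by presburger
    then show ?thesis using less.hyps[of ys] ys by auto
  qed
qed

section \<open>Short odd cycles through thick edges\<close>

text \<open>Every vertex has at most two \<open>T\<close>-neighbours on a shortest odd cycle of
  \<open>T\<close>, so its length \<open>M\<close> satisfies \<open>M * d \<le> 2 * card V\<close>.
  If no cycle as claimed exists, parity leaves only \<open>M = L\<close>, which a second count with
  all edges excludes.\<close>

lemma short_cycle_of_nonbipartite_thick:
  assumes V: "finite V" "E \<subseteq> V \<times> V" and E: "sym E" "irrefl E" and T: "T \<subseteq> E" "sym T"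
    and L: "7 \<le> L" "odd L"
    and degE: "\<And>v. v \<in> V \<Longrightarrow> k \<le> card (E `` {v})" "2 * card V < L * k"
    and degT: "\<And>v. v \<in> V \<Longrightarrow> d \<le> card (T `` {v})" "2 * card V < (L + 2) * d"
    and ex: "odd_cycle T ws"
  shows "\<exists>xs. odd_cycle E xs \<and> cycle_arcs xs \<inter> T \<noteq> {} \<and> length xs < L"
proof (rule ccontr)
  assume "\<not> ?thesis"
  then have long: "L \<le> length xs" if "odd_cycle E xs" "cycle_arcs xs \<inter> T \<noteq> {}" for xs
    using that by (meson not_le)
  obtain xs where xs: "odd_cycle T xs" and min: "\<And>ys. odd_cycle T ys \<Longrightarrow> length xs \<le> length ys"
    using ex_has_least_nat[of "odd_cycle T" ws length] ex by blast
  define M where "M = length xs"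
  have ne: "xs \<noteq> []" using odd_cycle_nonempty[OF xs] .
  define c where "c = (\<lambda>i. xs ! (i mod length xs))"
  have c: "cyclic_seq T M c" "range c = set xs" "cycle_arcs xs = range (\<lambda>i. (c i, c (Suc i)))"
    using odd_cycle_seq[OF _ ne, of T] xs by (auto simp: odd_cycle_def M_def c_def)
  have oddM: "odd M" using xs by (simp add: odd_cycle_def M_def)
  have xsE: "odd_cycle E xs" using xs T by (auto simp: odd_cycle_def)
  have "(c 0, c 1) \<in> cycle_arcs xs \<inter> T" using c xs by (auto simp: odd_cycle_def)
  then have "cycle_arcs xs \<inter> T \<noteq> {}" by blast
  then have LM: "L \<le> M" using long xsE M_def by blast
  have cV: "c i \<in> V" for i using c(1) T V by (auto simp: cyclic_seq_def)
  have irT: "irrefl T" using E T by (auto simp: irrefl_def)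
  have "M * d \<le> 2 * card V"
  proof (rule card_image_relation_le[OF V(1) T(2), of M d c])
    fix w assume "w \<in> V"
    have "(i + 2) mod M = j \<or> (j + 2) mod M = i"
      if "i < M" "j < M" "(w, c i) \<in> T" "(w, c j) \<in> T" "i \<noteq> j" for i j
      by (rule common_neighbour_distance_two[OF c(1) oddM _ T(2) irT that(3,4,1,2,5)])
        (simp add: M_def min)
    then show "card {i \<in> {..<M}. (w, c i) \<in> T} \<le> 2"
      using LM L(1) by (intro card_le_two_of_distance_two[of M]) auto
  qed (use T V degT cV in auto)
  then have "M < L + 2" using degT(2) by (metis le_less_trans mult_le_mono1 not_le)
  then have "M = L" using LM L(2) oddM by presburger
  \<comment> \<open>At length \<open>L\<close> the cycle is also shortest among the odd cycles of
    \<open>E\<close> that meet \<open>T\<close>. Hence the bound of two holds for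
    \<open>E\<close>-neighbours too, and the full degree \<open>k\<close> enters.\<close>
  have "M * k \<le> 2 * card V"
  proof (rule card_image_relation_le[OF V(1) E(1), of M k c])
    fix w assume "w \<in> V"
    have TE: "T \<union> E = E" using T by blast
    have "(i + 2) mod M = j \<or> (j + 2) mod M = i"
      if "i < M" "j < M" "(w, c i) \<in> E" "(w, c j) \<in> E" "i \<noteq> j" for i j
      by (rule common_neighbour_distance_two[OF c(1) oddM _ E that(3,4,1,2,5)])
        (simp add: TE \<open>M = L\<close> long)
    then show "card {i \<in> {..<M}. (w, c i) \<in> E} \<le> 2"
      using LM L(1) by (intro card_le_two_of_distance_two[of M]) auto
  qed (use V degE cV in auto)
  then show False using degE(2) \<open>M = L\<close> by simp
qed

text \<open>On a shortest odd cycle that meets \<open>T\<close>, only vertices at distance two can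
  share a \<open>T\<close>-neighbour. More than half of its vertices are chosen so that no two of
  them do; their disjoint neighbourhoods bound the length.\<close>

lemma short_cycle_of_bipartite_thick:
  assumes V: "finite V" "E \<subseteq> V \<times> V" and E: "sym E" "irrefl E" and T: "T \<subseteq> E" "sym T"
    and L: "7 \<le> L"
    and degT: "\<And>v. v \<in> V \<Longrightarrow> d \<le> card (T `` {v})" "2 * card V < (L + 1) * d"
    and col: "two_colouring T \<chi>"
    and ex: "odd_cycle E ws" "cycle_arcs ws \<inter> T \<noteq> {}"
  shows "\<exists>xs. odd_cycle E xs \<and> cycle_arcs xs \<inter> T \<noteq> {} \<and> length xs < L"
proof (rule ccontr)
  assume "\<not> ?thesis"
  then have long: "L \<le> length xs" if "odd_cycle E xs" "cycle_arcs xs \<inter> T \<noteq> {}" for xs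
    using that by (meson not_le)
  obtain xs where xs: "odd_cycle E xs" "cycle_arcs xs \<inter> T \<noteq> {}"
    and min: "\<And>ys. odd_cycle E ys \<Longrightarrow> cycle_arcs ys \<inter> T \<noteq> {} \<Longrightarrow> length xs \<le> length ys"
    using ex_has_least_nat[of "\<lambda>xs. odd_cycle E xs \<and> cycle_arcs xs \<inter> T \<noteq> {}" ws length] ex by blast
  define M where "M = length xs"
  have ne: "xs \<noteq> []" using odd_cycle_nonempty[OF xs(1)] .
  define c where "c = (\<lambda>i. xs ! (i mod length xs))"
  have c: "cyclic_seq E M c" "range c = set xs" "cycle_arcs xs = range (\<lambda>i. (c i, c (Suc i)))"
    using odd_cycle_seq[OF _ ne, of E] xs(1) by (auto simp: odd_cycle_def M_def c_def)
  have oddM: "odd M" using xs by (simp add: odd_cycle_def M_def)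
  then obtain h where h: "M = 2 * h + 1" by (auto elim: oddE)
  have LM: "L \<le> M" using long xs M_def by blast
  have cV: "c i \<in> V" for i using c(1) V by (auto simp: cyclic_seq_def)
  have irT: "irrefl T" using E T by (auto simp: irrefl_def)
  have cmod: "c i = c (i mod M)" for i using c(1) by (simp add: cyclic_seq_def)
  have ET: "E \<union> T = E" using T by blast
  have dist2: "(i + 2) mod M = j mod M \<or> (j + 2) mod M = i mod M"
    if "(w, c i) \<in> T" "(w, c j) \<in> T" "i mod M \<noteq> j mod M" for w i j
  proof -
    have "(i mod M + 2) mod M = j mod M \<or> (j mod M + 2) mod M = i mod M"
    proof (rule common_neighbour_distance_two[OF c(1) oddM _ T(2) irT])
      show "(w, c (i mod M)) \<in> T" "(w, c (j mod M)) \<in> T" using that cmod[of i] cmod[of j] by auto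
      show "i mod M < M" "j mod M < M" using LM L by auto
    qed (use that(3) min in \<open>auto simp: ET M_def\<close>)
    then show ?thesis by (simp only: mod_add_left_eq)
  qed
  \<comment> \<open>Otherwise the colour is constant along steps of two, hence on the whole cycle
    since \<open>M\<close> is odd, although the cycle has an arc in \<open>T\<close>.\<close>
  have "\<exists>s. T `` {c s} \<inter> T `` {c (s + 2)} = {}"
  proof (rule ccontr)
    assume "\<not> ?thesis"
    then have meet: "T `` {c s} \<inter> T `` {c (s + 2)} \<noteq> {}" for s by blast
    have step: "\<chi> (c s) = \<chi> (c (s + 2))" for s
    proof -
      obtain w where "(c s, w) \<in> T" "(c (s + 2), w) \<in> T" using meet[of s] by blast
      then show ?thesis using col unfolding two_colouring_def by blast
    qed
    have ev: "\<chi> (c (s + 2 * n)) = \<chi> (c s)" for s n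
    proof (induction n)
      case (Suc n)
      then show ?case using step[of "s + 2 * n"] by simp
    qed simp
    have "\<chi> (c (Suc s)) = \<chi> (c s)" for s
    proof -
      have "\<chi> (c (Suc s + 2 * h)) = \<chi> (c (Suc s))" by (rule ev)
      moreover have "c (Suc s + 2 * h) = c s" using cyclic_seq_add[OF c(1), of s] h by (simp add: ac_simps)
      ultimately show ?thesis by simp
    qed
    moreover obtain a where "(c a, c (Suc a)) \<in> T" using xs(2) c(3) by auto
    ultimately show False using col unfolding two_colouring_def by blast
  qed
  then obtain s where s: "T `` {c s} \<inter> T `` {c (s + 2)} = {}" by blast
  \<comment> \<open>Indices that differ by \<open>4 * e\<close> with
    \<open>1 \<le> e \<le> h\<close> are at cyclic distance two only if \<open>M\<close> divides
    \<open>2 * e - 1\<close> or \<open>2 * e + 1\<close>, which forces \<open>e = h\<close>. The one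
    remaining pair is \<open>v 0 = c (s + 2)\<close> and \<open>v h = c s\<close>, disjoint by the
    choice of \<open>s\<close>.\<close>
  define v where "v j = c (s + 2 + 4 * j)" for j
  have disj: "T `` {v a} \<inter> T `` {v b} = {}" if ab: "a < b" "b \<le> h" for a b
  proof (rule ccontr)
    assume "\<not> ?thesis"
    then obtain w where w: "(w, v a) \<in> T" "(w, v b) \<in> T" using T(2) by (auto dest: symD)
    define e where "e = b - a"
    have e: "1 \<le> e" "e \<le> h" "b = a + e" using ab by (auto simp: e_def)
    let ?x = "s + 2 + 4 * a"
    have cop: "coprime M 2" using oddM by simp
    have small: False if "M dvd f" "0 < f" "f < M" for f using that by (auto dest: dvd_imp_le)
    have "?x mod M \<noteq> (?x + 4 * e) mod M"
    proof
      assume "?x mod M = (?x + 4 * e) mod M"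
      then have "M dvd (?x + 4 * e) - ?x" using mod_eq_dvd_iff_nat[of ?x "?x + 4 * e" M] by simp
      then have "M dvd 2 * (2 * e)" by simp
      then have "M dvd 2 * e" using cop coprime_dvd_mult_right_iff by blast
      then show False using small[of "2 * e"] e h by auto
    qed
    then have "(?x + 2) mod M = (?x + 4 * e) mod M \<or> (?x + 4 * e + 2) mod M = ?x mod M"
      using dist2[of w ?x "?x + 4 * e"] w e(3) by (simp add: v_def algebra_simps)
    then consider "M dvd 2 * (2 * e - 1)" | "M dvd 2 * (2 * e + 1)"
    proof
      assume "(?x + 2) mod M = (?x + 4 * e) mod M"
      then have "M dvd (?x + 4 * e) - (?x + 2)"
        using mod_eq_dvd_iff_nat[of "?x + 2" "?x + 4 * e" M] e by simp
      moreover have "(?x + 4 * e) - (?x + 2) = 2 * (2 * e - 1)" using e by simp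
      ultimately show ?thesis using that by metis
    next
      assume "(?x + 4 * e + 2) mod M = ?x mod M"
      then have "M dvd (?x + 4 * e + 2) - ?x"
        using mod_eq_dvd_iff_nat[of ?x "?x + 4 * e + 2" M] e by simp
      moreover have "(?x + 4 * e + 2) - ?x = 2 * (2 * e + 1)" by simp
      ultimately show ?thesis using that by metis
    qed
    then show False
    proof cases
      case 1
      then have "M dvd 2 * e - 1" using cop coprime_dvd_mult_right_iff by blast
      moreover have "0 < 2 * e - 1" "2 * e - 1 < M" using e h by linarith+
      ultimately show False by (rule small)
    next
      case 2
      then have "M dvd 2 * e + 1" using cop coprime_dvd_mult_right_iff by blast
      then have "\<not> 2 * e + 1 < M" using small[of "2 * e + 1"] by auto
      then have "e = h" using e h by linarith
      then have eq: "a = 0" "b = h" using e ab by auto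
      \<comment> \<open>\<open>s + 2 + 4 * h\<close> equals \<open>s + 2 * M\<close>.\<close>
      have "v h = c (s + M + M)" using h unfolding v_def by (intro arg_cong[where f = c]) simp
      then have "v h = c s" using cyclic_seq_add[OF c(1)] by simp
      then show False using w s eq T(2) by (auto simp: v_def dest: symD)
    qed
  qed
  have "(h + 1) * d \<le> 1 * card V"
  proof (rule card_image_relation_le[OF V(1) T(2), of "h + 1" d v])
    fix w assume "w \<in> V"
    have "i = j" if "i \<le> h" "j \<le> h" "(w, v i) \<in> T" "(w, v j) \<in> T" for i j
    proof (rule ccontr)
      assume "i \<noteq> j"
      then have "T `` {v i} \<inter> T `` {v j} = {}"
        using disj[of i j] disj[of j i] that by (metis Int_commute linorder_neqE_nat)
      moreover have "w \<in> T `` {v i}" "w \<in> T `` {v j}" using that T(2) by (auto dest: symD)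
      ultimately show False by blast
    qed
    then have "{i \<in> {..<h + 1}. (w, v i) \<in> T} \<subseteq> {SOME i. i \<le> h \<and> (w, v i) \<in> T}"
      by (auto intro!: some_equality[symmetric])
    then show "card {i \<in> {..<h + 1}. (w, v i) \<in> T} \<le> 1"
      using card_mono[of "{SOME i. i \<le> h \<and> (w, v i) \<in> T}"] by simp
  qed (use T V degT cV in \<open>auto simp: v_def\<close>)
  moreover have "(L + 1) * d \<le> 2 * (h + 1) * d" using LM h by (intro mult_le_mono1) simp
  ultimately show False using degT(2) by (simp add: algebra_simps)
qed

section \<open>Odd cycles through thick edges in regular graphs\<close>

text \<open>The arc from \<open>c 0\<close> to \<open>w\<close> and the ear \<open>p\<close> lead to
  \<open>c j\<close>; from there either arc of the cycle returns to \<open>c 0\<close>. As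
  \<open>M\<close> is odd, the two resulting cycles differ in parity. For empty \<open>p\<close> the
  ear is the single arc from \<open>c 0\<close> to \<open>w = c j\<close>.\<close>

lemma odd_cycle_through_ear:
  assumes E: "sym E" and c: "cyclic_seq E M c" "odd M"
    and p: "distinct (p @ [c j])" "path_arcs (p @ [c j]) \<subseteq> E" "set p \<inter> range c = {}"
    and w: "w = hd (p @ [c j])" "(c 0, w) \<in> E" and j: "0 < j" "j < M"
  shows "\<exists>ys. odd_cycle E ys \<and> (c 0, w) \<in> cycle_arcs ys"
proof -
  let ?A = "map c [j..<Suc M]" and ?B = "map c [0..<Suc j]"
  have cM: "c M = c 0" using cyclic_seq_add[OF c(1), of 0] by simp
  have A: "hd ?A = c j" "last ?A = c 0" "?A \<noteq> []" using j cM by (auto simp: hd_map simp del: upt_Suc)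
    (simp add: last_map)
  have B: "hd (rev ?B) = c j" "last (rev ?B) = c 0" "rev ?B \<noteq> []"
    by (auto simp: hd_rev last_map last_rev hd_map simp del: upt_Suc)
  have E': "path_arcs ?A \<subseteq> E" "path_arcs (rev ?B) \<subseteq> E"
    using c(1) E unfolding path_arcs_rev path_arcs_map_upt by (auto simp: cyclic_seq_def dest: symD)
  have D: "distinct ?A" "distinct (rev ?B)"
    using cyclic_seq_distinct[OF c(1), of "Suc M" j] cyclic_seq_distinct[OF c(1), of "Suc j" 0] j
    by (auto simp del: upt_Suc)
  have ok: "distinct (p @ zs) \<and> cycle_arcs (p @ zs) \<subseteq> E \<and> (c 0, w) \<in> cycle_arcs (p @ zs)"
    if zs: "hd zs = c j" "last zs = c 0" "zs \<noteq> []" "path_arcs zs \<subseteq> E" "distinct zs" "set zs \<subseteq> range c" for zs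
  proof -
    have "hd (p @ zs) = w" using zs w by (cases p) auto
    then have ca: "cycle_arcs (p @ zs) = insert (c 0, w) (path_arcs (p @ zs))"
      using zs by (simp add: cycle_arcs_eq)
    have "path_arcs (p @ zs) = path_arcs (p @ [c j]) \<union> path_arcs zs"
      using path_arcs_append[of p "c j" "tl zs"] zs by (metis list.collapse)
    then show ?thesis using ca zs p w by auto
  qed
  have 1: "distinct (p @ ?A) \<and> cycle_arcs (p @ ?A) \<subseteq> E \<and> (c 0, w) \<in> cycle_arcs (p @ ?A)"
    by (rule ok[OF A E'(1) D(1)]) auto
  have 2: "distinct (p @ rev ?B) \<and> cycle_arcs (p @ rev ?B) \<subseteq> E \<and> (c 0, w) \<in> cycle_arcs (p @ rev ?B)"
    by (rule ok[OF B E'(2) D(2)]) auto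
  have "odd (length (p @ ?A)) \<or> odd (length (p @ rev ?B))" using j c(2) by auto
  then show ?thesis using 1 2 unfolding odd_cycle_def by blast
qed

lemma rtrancl_imp_simple_path:
  assumes "(u, v) \<in> E\<^sup>*"
  shows "\<exists>xs. xs \<noteq> [] \<and> hd xs = u \<and> last xs = v \<and> distinct xs \<and> path_arcs xs \<subseteq> E"
  using assms
proof (induction rule: rtrancl_induct)
  case base
  show ?case by (intro exI[of _ "[u]"]) simp
next
  case (step y z)
  then obtain xs where xs: "xs \<noteq> []" "hd xs = u" "last xs = y" "distinct xs" "path_arcs xs \<subseteq> E" by blast
  show ?case
  proof (cases "z \<in> set xs")
    case True
    then obtain as bs where s: "xs = as @ z # bs" by (meson split_list)
    have "path_arcs (as @ [z]) \<subseteq> E" using xs(5) path_arcs_append[of as z bs] by (simp add: s)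
    then show ?thesis using xs s by (intro exI[of _ "as @ [z]"]) (cases as; auto)
  next
    case False
    then show ?thesis using xs step(2) by (intro exI[of _ "xs @ [z]"]) (auto simp: path_arcs_snoc)
  qed
qed

lemma path_to_set:
  assumes "(u, v) \<in> E\<^sup>*" "v \<in> S"
  shows "\<exists>p z. z \<in> S \<and> distinct (p @ [z]) \<and> path_arcs (p @ [z]) \<subseteq> E \<and> set p \<inter> S = {} \<and> hd (p @ [z]) = u"
proof -
  obtain xs where xs: "xs \<noteq> []" "hd xs = u" "last xs = v" "distinct xs" "path_arcs xs \<subseteq> E"
    using rtrancl_imp_simple_path[OF assms(1)] by blast
  have "\<exists>x \<in> set xs. x \<in> S" using xs assms(2) by (metis last_in_set)
  then obtain p z bs where s: "xs = p @ z # bs" "z \<in> S" "\<forall>y \<in> set p. y \<notin> S"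
    using split_list_first_prop[of xs "\<lambda>x. x \<in> S"] by blast
  have "path_arcs (p @ [z]) \<subseteq> E" using xs(5) path_arcs_append[of p z bs] by (simp add: s)
  then show ?thesis using s xs by (intro exI[of _ p] exI[of _ z]) (cases p; auto)
qed

lemma card_bipartite_degrees:
  assumes "finite A" "finite B" "sym E"
    and "\<And>a. a \<in> A \<Longrightarrow> E `` {a} \<subseteq> B" "\<And>b. b \<in> B \<Longrightarrow> E `` {b} \<subseteq> A"
  shows "(\<Sum>a\<in>A. card (E `` {a})) = (\<Sum>b\<in>B. card (E `` {b}))"
proof -
  have "(\<Sum>a\<in>A. card (E `` {a})) = (\<Sum>a\<in>A. card {b \<in> B. (a, b) \<in> E})"
    using assms(4) by (intro sum.cong arg_cong[where f = card]) auto
  also have "\<dots> = (\<Sum>b\<in>B. card {a \<in> A. (a, b) \<in> E})"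
    using assms by (intro sum_multicount_gen) auto
  also have "\<dots> = (\<Sum>b\<in>B. card (E `` {b}))"
    using assms(3,5) by (intro sum.cong arg_cong[where f = card]) (auto dest: symD)
  finally show ?thesis .
qed

text \<open>The set \<open>K \<union> {x}\<close> chosen in the proof plays the role of an end block: a bipartite end block
  is impossible in a regular graph, because counting its edges from both sides shows that \<open>k\<close>
  divides the degree of its cut vertex \<open>x\<close>.\<close>

lemma odd_cycle_through_given_arcs:
  assumes V: "finite V" "E \<subseteq> V \<times> V" "2 \<le> card V" and E: "sym E" "irrefl E"
    and reg: "\<And>v. v \<in> V \<Longrightarrow> card (E `` {v}) = k"
    and conn: "\<And>U. U \<subseteq> V \<Longrightarrow> U \<noteq> {} \<Longrightarrow> E `` U \<subseteq> U \<Longrightarrow> U = V"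
    and nonbip: "\<nexists>\<chi>. two_colouring E \<chi>"
    and T: "T \<subseteq> E" "\<And>v. v \<in> V \<Longrightarrow> T `` {v} \<noteq> {}"
  shows "\<exists>xs. odd_cycle E xs \<and> cycle_arcs xs \<inter> T \<noteq> {}"
proof -
  \<comment> \<open>Such a \<open>K\<close> is cut off from the rest by the single vertex
    \<open>x\<close>, or is everything but \<open>x\<close>. A smallest one is chosen.\<close>
  define P where "P K \<longleftrightarrow> K \<noteq> {} \<and> K \<subseteq> V \<and> (\<exists>x \<in> V - K. E `` K \<subseteq> insert x K)" for K
  obtain x0 where "x0 \<in> V" using V(3) by fastforce
  moreover have "V - {x0} \<noteq> {}"
  proof
    assume "V - {x0} = {}"
    then have "card V \<le> card {x0}" by (intro card_mono) auto
    then show False using V(3) by simp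
  qed
  ultimately have "P (V - {x0})" unfolding P_def using V(2) by auto
  then obtain K where K: "P K" and min: "\<And>K'. P K' \<Longrightarrow> card K \<le> card K'"
    using ex_has_least_nat[of P _ card] by blast
  then obtain x where x: "x \<in> V" "x \<notin> K" "E `` K \<subseteq> insert x K" and K': "K \<noteq> {}" "K \<subseteq> V"
    by (auto simp: P_def)
  have finK: "finite K" using K'(2) V(1) finite_subset by blast
  have minK: "K' = K" if "K' \<subseteq> K" "P K'" for K'
    using that min finK by (meson card_seteq)
  define H where "H = E \<inter> (insert x K \<times> insert x K)"
  have symH: "sym H" using E(1) by (auto simp: H_def sym_def)
  have HK: "H `` {v} = E `` {v}" if "v \<in> K" for v using that x(3) by (auto simp: H_def)
  have "\<nexists>\<chi>. two_colouring H \<chi>"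
  proof
    assume "\<exists>\<chi>. two_colouring H \<chi>"
    then obtain \<chi> where \<chi>: "two_colouring H \<chi>" by blast
    define A where "A = {v \<in> K. \<chi> v = \<chi> x}"
    define B where "B = {v \<in> K. \<chi> v \<noteq> \<chi> x}"
    have col: "\<chi> u \<noteq> \<chi> v" if "(u, v) \<in> H" for u v using \<chi> that by (auto simp: two_colouring_def)
    have "x \<notin> A" using x by (simp add: A_def)
    have "(\<Sum>a\<in>insert x A. card (H `` {a})) = (\<Sum>b\<in>B. card (H `` {b}))"
    proof (rule card_bipartite_degrees[OF _ _ symH])
      have HxK: "u \<in> insert x K \<and> v \<in> insert x K" if "(u, v) \<in> H" for u v
        using that unfolding H_def by blast
      show "H `` {a} \<subseteq> B" if "a \<in> insert x A" for a
      proof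
        fix v assume "v \<in> H `` {a}"
        then have "(a, v) \<in> H" by simp
        then show "v \<in> B" using that col[of a v] HxK[of a v] by (auto simp: A_def B_def)
      qed
      show "H `` {b} \<subseteq> insert x A" if "b \<in> B" for b
      proof
        fix v assume "v \<in> H `` {b}"
        then have "(b, v) \<in> H" by simp
        then show "v \<in> insert x A" using that col[of b v] HxK[of b v] by (auto simp: A_def B_def)
      qed
    qed (use finK in \<open>auto simp: A_def B_def\<close>)
    moreover have "(\<Sum>a\<in>A. card (H `` {a})) = card A * k" "(\<Sum>b\<in>B. card (H `` {b})) = card B * k"
      using HK reg K'(2) by (auto simp: A_def B_def subset_iff)
    ultimately have eq: "card (H `` {x}) + card A * k = card B * k"
      using finK \<open>x \<notin> A\<close> by (simp add: A_def)
    then have dvd: "k dvd card (H `` {x})" by (metis dvd_add_left_iff dvd_triv_right)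
    have fin: "finite (E `` {x})" using V by (meson finite_subset finite_SigmaI finite_Image)
    have sub: "H `` {x} \<subseteq> E `` {x}" by (auto simp: H_def)
    have "H `` {x} \<noteq> {}"
    proof
      assume "H `` {x} = {}"
      then have "E `` K \<subseteq> K" using x(3) K' E(1) by (auto simp: H_def dest: symD)
      then show False using conn[of K] K' x by auto
    qed
    then have "0 < card (H `` {x})" using fin sub finite_subset by (metis card_gt_0_iff)
    then have "k \<le> card (H `` {x})" using dvd by (simp add: dvd_imp_le)
    \<comment> \<open>Now \<open>x\<close> has all its neighbours in \<open>K\<close>, so by
      connectedness \<open>insert x K\<close> is all of \<open>V\<close>, and \<open>E\<close>
      itself would be two-coloured.\<close>
    then have Hx: "H `` {x} = E `` {x}" using sub fin reg x(1) by (intro card_seteq) auto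
    have "E `` insert x K \<subseteq> insert x K" using x(3) Hx by (auto simp: H_def)
    then have "insert x K = V" using conn[of "insert x K"] x K' by auto
    then have "H = E" using V(2) by (auto simp: H_def)
    then show False using \<chi> nonbip by blast
  qed
  then obtain ds where ds: "odd_cycle H ds" using two_colouring_or_odd_cycle[OF symH] by blast
  have irH: "irrefl H" using E(2) by (auto simp: H_def irrefl_def)
  define M where "M = length ds"
  have ne: "ds \<noteq> []" using odd_cycle_nonempty[OF ds] .
  define c0 where "c0 = (\<lambda>i. ds ! (i mod length ds))"
  have c0: "cyclic_seq H M c0"
    using odd_cycle_seq[OF _ ne, of H] ds by (auto simp: odd_cycle_def M_def c0_def)
  have oddM: "odd M" using ds by (simp add: odd_cycle_def M_def)
  have M1: "M \<noteq> 1"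
  proof
    assume "M = 1"
    then have "c0 0 = c0 (Suc 0)" using c0 by (simp add: cyclic_seq_def)
    then show False using c0 irH by (metis cyclic_seq_def irrefl_def)
  qed
  then have M3: "3 \<le> M" using oddM by presburger
  have in_xK: "c0 i \<in> insert x K" for i using c0 by (auto simp: cyclic_seq_def H_def)
  \<comment> \<open>Only \<open>x\<close> lies outside \<open>K\<close> in \<open>H\<close>, so of
    two distinct vertices of the cycle one lies in \<open>K\<close>. The cycle is restarted there,
    at \<open>y\<close>.\<close>
  have "c0 0 \<noteq> c0 1" using c0 M3 by (simp add: cyclic_seq_def)
  then obtain r where r: "c0 r \<in> K" using in_xK[of 0] in_xK[of 1] by auto
  define c where "c i = c0 (r + i)" for i
  have c: "cyclic_seq H M c" unfolding cyclic_seq_def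
  proof (intro conjI allI)
    fix i j
    show "(c i = c j) = (i mod M = j mod M)"
      using c0 by (auto simp: c_def cyclic_seq_def nat_mod_eq_iff)
    show "(c i, c (Suc i)) \<in> H" using c0 by (simp add: c_def cyclic_seq_def)
  qed
  define y where "y = c 0"
  have y: "y \<in> K" using r by (simp add: y_def c_def)
  obtain w where w: "(y, w) \<in> T" using T(2) y K' by blast
  have wH: "(y, w) \<in> H" using w T(1) y x(3) by (auto simp: H_def)
  have wy: "w \<noteq> y" using wH irH by (auto simp: irrefl_def)
  define J where "J = H \<inter> ((- {y}) \<times> (- {y}))"
  have symJ: "sym J" using symH by (auto simp: J_def sym_def)
  \<comment> \<open>Deleting \<open>y\<close> leaves \<open>H\<close> connected: the vertices of
    \<open>K\<close> then cut off from \<open>x\<close> would form a set \<open>K1\<close> separated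
    by \<open>y\<close> alone, and minimality of \<open>K\<close> would give \<open>K1 = K\<close>,
    which contains \<open>y\<close>.\<close>
  have reach: "(x, z) \<in> J\<^sup>*" if z: "z \<in> insert x K" "z \<noteq> y" for z
  proof (rule ccontr)
    assume nr: "(x, z) \<notin> J\<^sup>*"
    define K1 where "K1 = {v \<in> K. v \<noteq> y \<and> (x, v) \<notin> J\<^sup>*}"
    have "E `` K1 \<subseteq> insert y K1"
    proof
      fix v assume "v \<in> E `` K1"
      then obtain u where u: "u \<in> K" "u \<noteq> y" "(x, u) \<notin> J\<^sup>*" "(u, v) \<in> E" by (auto simp: K1_def)
      have vx: "v \<in> insert x K" using u x(3) by blast
      show "v \<in> insert y K1"
      proof (rule ccontr)
        assume nv: "v \<notin> insert y K1"
        then have "(x, v) \<in> J\<^sup>*" using vx by (auto simp: K1_def)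
        moreover have "(v, u) \<in> J" using u nv vx E(1) by (auto simp: J_def H_def dest: symD)
        ultimately show False using u(3) by (meson rtrancl.rtrancl_into_rtrancl)
      qed
    qed
    moreover have "z \<in> K1" using z nr by (auto simp: K1_def)
    moreover have "y \<in> V - K1" using y K' by (auto simp: K1_def)
    moreover have "K1 \<subseteq> K" by (auto simp: K1_def)
    ultimately have "P K1" unfolding P_def using K' by blast
    then have "K1 = K" using minK \<open>K1 \<subseteq> K\<close> by blast
    then show False using y by (auto simp: K1_def)
  qed
  have "0 mod M \<noteq> 1 mod M" using M3 by simp
  then have c1: "c 1 \<noteq> y" "c 1 \<in> insert x K"
    using c in_xK[of "r + 1"] unfolding y_def cyclic_seq_def by (metis, simp add: c_def)
  have "w \<in> insert x K" using wH unfolding H_def by blast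
  then have "(x, w) \<in> J\<^sup>*" using wy by (rule reach)
  then have "(w, x) \<in> J\<^sup>*" by (rule symD[OF sym_rtrancl[OF symJ]])
  then have "(w, c 1) \<in> J\<^sup>*" using reach[OF c1(2,1)] by (rule rtrancl_trans)
  \<comment> \<open>The path from \<open>w\<close> is cut at its first cycle vertex other than
    \<open>y\<close>. Arcs of \<open>J\<close> avoid \<open>y\<close>, so the part before it is an
    ear.\<close>
  then obtain p z where p: "z \<in> range c - {y}" "distinct (p @ [z])" "path_arcs (p @ [z]) \<subseteq> J"
    "set p \<inter> (range c - {y}) = {}" "hd (p @ [z]) = w"
    using path_to_set[of w "c 1" J "range c - {y}"] c1 by blast
  have "y \<notin> set p"
  proof
    assume "y \<in> set p"
    then obtain as bs where s: "p = as @ y # bs" by (meson split_list)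
    have "path_arcs (p @ [z]) \<supseteq> path_arcs (y # bs @ [z])"
      using path_arcs_append[of as y "bs @ [z]"] by (simp add: s)
    then have "(y, hd (bs @ [z])) \<in> J" using p(3) by (auto simp: path_arcs_Cons)
    then show False by (simp add: J_def)
  qed
  then have p4: "set p \<inter> range c = {}" using p(4) by blast
  obtain j' where j': "z = c j'" "z \<noteq> y" using p(1) by blast
  define j where "j = j' mod M"
  have "c j = z" using c j' by (simp add: j_def cyclic_seq_def)
  have "j \<noteq> 0"
  proof
    assume "j = 0" then show False using \<open>c j = z\<close> j' y_def by simp
  qed
  then have j: "0 < j" "j < M" "z = c j" using M3 \<open>c j = z\<close> by (auto simp: j_def)
  have "\<exists>ys. odd_cycle H ys \<and> (c 0, w) \<in> cycle_arcs ys"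
  proof (rule odd_cycle_through_ear[OF symH c oddM])
    show "distinct (p @ [c j])" "w = hd (p @ [c j])" "(c 0, w) \<in> H"
      using p j wH by (simp_all add: y_def)
    show "path_arcs (p @ [c j]) \<subseteq> H" using p(3) j by (auto simp: J_def)
  qed (use p4 j in auto)
  then obtain ys where ys: "odd_cycle H ys" "(y, w) \<in> cycle_arcs ys" by (auto simp: y_def)
  have "H \<subseteq> E" by (simp add: H_def)
  then have "odd_cycle E ys" using ys(1) unfolding odd_cycle_def by blast
  then show ?thesis using ys(2) w by blast
qed

section \<open>The upper bound\<close>

text \<open>Every vertex has thick degree at least \<open>d = k - m\<close>, and
  \<open>large\<close> makes \<open>m\<close> so small against \<open>k\<close> that the density
  bound survives with \<open>d\<close> in place of \<open>k\<close>. A thick odd cycle shorter than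
  \<open>2 * l + 1\<close> has length at most \<open>2 * l - 1\<close> by parity and is lengthened
  to exactly that.\<close>

lemma cycle_in_regular_nonbipartite:
  fixes E :: "('a \<times> 'a) set"
  assumes V: "finite V" "E \<subseteq> V \<times> V" and E: "sym E" "irrefl E"
    and reg: "\<And>v. v \<in> V \<Longrightarrow> card (E `` {v}) = k"
    and conn: "\<And>U. U \<subseteq> V \<Longrightarrow> U \<noteq> {} \<Longrightarrow> E `` U \<subseteq> U \<Longrightarrow> U = V"
    and nonbip: "\<nexists>\<chi>. two_colouring E \<chi>"
    and l: "3 \<le> l" and dense: "2 * card V < (2 * l + 1) * k"
    and large: "2 ^ (2 * l * (2 * l + 1) + 1) * (2 * l) \<le> k"
  shows "\<exists>xs. odd_cycle E xs \<and> length xs = 2 * l - 1"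
proof -
  define t L m where "t = 2 * l" and "L = 2 * l + 1" and "m = t * L"
  define T where "T = thick t E"
  define d where "d = k - m"
  have T: "T \<subseteq> E" "sym T" unfolding T_def by (simp_all add: thick_subset sym_thick E(1))
  \<comment> \<open>Exactly what turns \<open>L * k\<close> into at most \<open>(L + 1) * d\<close>;
    the exponential in \<open>large\<close> exceeds the linear amount required here.\<close>
  have km: "(L + 1) * m \<le> k"
  proof -
    have "m + 1 \<le> 2 ^ m" by (induction m) auto
    then have "2 * m * t \<le> 2 ^ (m + 1) * t" by (intro mult_le_mono1) simp
    also have "\<dots> \<le> k" using large by (simp add: t_def m_def L_def)
    finally have "2 * m * t \<le> k" .
    moreover have "(L + 1) * m \<le> 2 * t * m" using l by (intro mult_le_mono1) (simp add: L_def t_def)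
    ultimately show ?thesis by (simp add: ac_simps)
  qed
  have m0: "0 < m" using l by (simp add: m_def t_def L_def)
  have mk: "2 * m \<le> k"
  proof -
    have "2 * m \<le> (L + 1) * m" by (intro mult_le_mono1) (simp add: L_def)
    then show ?thesis using km by linarith
  qed
  have degT: "d \<le> card (T `` {v})" if "v \<in> V" for v
  proof -
    have fin: "finite (E `` {v})" using V by (meson finite_subset finite_SigmaI finite_Image)
    have "card (E `` {v} - T `` {v}) < m"
      unfolding T_def m_def using V E(1) reg dense large l
      by (intro few_thin_neighbours[where V = V and k = k]) (auto simp: t_def L_def)
    moreover have "card (E `` {v} - T `` {v}) = card (E `` {v}) - card (T `` {v})"
      using fin T by (intro card_Diff_subset) (auto intro: finite_subset)
    ultimately show ?thesis using reg[OF that] by (simp add: d_def)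
  qed
  have d0: "0 < d" using mk m0 by (simp add: d_def)
  have Ld: "L * k \<le> (L + 1) * d"
    using km mk by (simp add: d_def algebra_simps diff_mult_distrib2)
  have "E \<noteq> {}" using nonbip by (auto simp: two_colouring_def)
  then obtain u v where "(u, v) \<in> E" by auto
  then have "{u, v} \<subseteq> V" "u \<noteq> v" using V(2) E(2) by (auto simp: irrefl_def)
  then have V2: "2 \<le> card V" using V(1) by (metis card_2_iff card_mono)
  have "\<exists>xs. odd_cycle E xs \<and> cycle_arcs xs \<inter> T \<noteq> {} \<and> length xs < L"
  proof (cases "\<exists>\<chi>. two_colouring T \<chi>")
    case True
    then obtain \<chi> where \<chi>: "two_colouring T \<chi>" by blast
    have "T `` {v} \<noteq> {}" if "v \<in> V" for v using degT[OF that] d0 by (metis card.empty not_le)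
    then obtain ws where ws: "odd_cycle E ws" "cycle_arcs ws \<inter> T \<noteq> {}"
      using odd_cycle_through_given_arcs[OF V V2 E reg conn nonbip T(1)] by blast
    have "2 * card V < (L + 1) * d" using dense Ld by (simp add: L_def)
    then show ?thesis
      using l degT by (intro short_cycle_of_bipartite_thick[OF V E T _ _ _ \<chi> ws]) (auto simp: L_def)
  next
    case False
    then obtain ws where ws: "odd_cycle T ws" using two_colouring_or_odd_cycle[OF T(2)] by blast
    have "(L + 1) * d \<le> (L + 2) * d" by simp
    then have "2 * card V < (L + 2) * d" using dense Ld by (simp add: L_def)
    then show ?thesis
      using l degT reg dense
      by (intro short_cycle_of_nonbipartite_thick[OF V E T, where k = k and d = d])
        (use ws in \<open>auto simp: L_def\<close>)
  qed
  then obtain xs where xs: "odd_cycle E xs" "cycle_arcs xs \<inter> T \<noteq> {}" "length xs < L" by blast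
  have "odd (length xs)" using xs(1) by (simp add: odd_cycle_def)
  then have "length xs \<le> 2 * l - 1" using xs(3) unfolding L_def by presburger
  moreover have "odd (2 * l - 1)" using l by auto
  moreover have "2 * l - 1 \<le> t" by (simp add: t_def)
  ultimately show ?thesis using extend_thick_cycle_to[OF E xs(1)] xs(2) unfolding T_def by blast
qed

lemma regular_bipartite_sides:
  assumes V: "finite V" "E \<subseteq> V \<times> V" and E: "sym E"
    and reg: "\<And>v. v \<in> V \<Longrightarrow> card (E `` {v}) = k" and k: "0 < k"
    and \<chi>: "two_colouring E \<chi>"
  shows "card {v \<in> V. \<chi> v} = card {v \<in> V. \<not> \<chi> v}" "card V = 2 * card {v \<in> V. \<chi> v}"
proof -
  let ?A = "{v \<in> V. \<chi> v}" and ?B = "{v \<in> V. \<not> \<chi> v}"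
  have "(\<Sum>a\<in>?A. card (E `` {a})) = (\<Sum>b\<in>?B. card (E `` {b}))"
    using V E \<chi> by (intro card_bipartite_degrees) (auto simp: two_colouring_def)
  then have "card ?A * k = card ?B * k" using reg by simp
  then show eq: "card ?A = card ?B" using k by simp
  have "card V = card (?A \<union> ?B)" by (rule arg_cong[where f = card]) auto
  also have "\<dots> = card ?A + card ?B" using V by (intro card_Un_disjoint) auto
  finally show "card V = 2 * card ?A" using eq by simp
qed

text \<open>The linear order selects one arc from each pair of opposite arcs.\<close>

lemma even_card_symmetric:
  fixes E :: "('a::linorder \<times> 'a) set"
  assumes "finite E" "sym E" "irrefl E"
  shows "even (card E)"
proof -
  define A where "A = {(u, v) \<in> E. u < v}"
  have E: "E = A \<union> A\<inverse>" using assms(2,3) by (auto simp: A_def irrefl_def dest: symD)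
  have "A \<inter> A\<inverse> = {}" by (auto simp: A_def)
  moreover have "finite A" using assms(1) by (rule rev_finite_subset) (auto simp: A_def)
  ultimately have "card (A \<union> A\<inverse>) = card A + card (A\<inverse>)" by (intro card_Un_disjoint) auto
  then show ?thesis using E by simp
qed

lemma even_degree_of_odd_order:
  fixes E :: "('a::linorder \<times> 'a) set"
  assumes V: "finite V" "E \<subseteq> V \<times> V" "odd (card V)" and E: "sym E" "irrefl E"
    and reg: "\<And>v. v \<in> V \<Longrightarrow> card (E `` {v}) = k"
  shows "even k"
proof -
  have "E = Sigma V (\<lambda>v. E `` {v})" using V(2) by auto
  moreover have "finite (E `` {v})" for v using V by (meson finite_subset finite_SigmaI finite_Image)
  ultimately have "card E = (\<Sum>v\<in>V. card (E `` {v}))" using V(1) by (metis card_SigmaI)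
  also have "\<dots> = card V * k" using reg by simp
  finally have "even (card V * k)"
    using even_card_symmetric[OF _ E] V by (metis finite_SigmaI finite_subset)
  then show ?thesis using V(3) by simp
qed

text \<open>For even order, \<open>k\<close> above half the order forces connectedness and excludes
  two-colourings. For odd order, a component of odd order is used; it is not bipartite because a
  regular bipartite graph of positive degree has equal sides.\<close>

lemma cycle_in_dense_regular:
  fixes E :: "('a::linorder \<times> 'a) set"
  assumes V: "finite V" "E \<subseteq> V \<times> V" "V \<noteq> {}" and E: "sym E" "irrefl E"
    and reg: "\<And>v. v \<in> V \<Longrightarrow> card (E `` {v}) = k"
    and l: "3 \<le> l"
    and big: "(if even (card V) then card V div 2 else 2 * (card V div (2 * l + 1))) < k"
    and large: "2 ^ (2 * l * (2 * l + 1) + 1) * (2 * l) \<le> k"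
  shows "\<exists>xs. odd_cycle E xs \<and> length xs = 2 * l - 1"
proof (cases "even (card V)")
  case True
  then have half: "card V < 2 * k" using big by auto
  have k0: "0 < k" using half by simp
  show ?thesis
  proof (rule cycle_in_regular_nonbipartite[OF V(1,2) E reg _ _ l _ large])
    show "U = V" if U: "U \<subseteq> V" "U \<noteq> {}" "E `` U \<subseteq> U" for U
    proof (rule ccontr)
      assume "U \<noteq> V"
      have finU: "finite U" using U V finite_subset by blast
      obtain u where u: "u \<in> U" using U by blast
      \<comment> \<open>A closed set and its complement would each contain a whole neighbourhood,
        that is, at least \<open>k\<close> vertices.\<close>
      have "k \<le> card U" using reg[of u] u U finU by (metis ImageI card_mono singletonD subset_iff Image_singleton_iff)
      obtain v where v: "v \<in> V - U" using U \<open>U \<noteq> V\<close> by blast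
      have "w \<notin> U" if "(v, w) \<in> E" for w using that v U E(1) by (meson DiffD2 ImageI subset_iff symD)
      then have "E `` {v} \<subseteq> V - U" using V(2) by auto
      then have "k \<le> card (V - U)" using reg[of v] v V(1) by (metis DiffD1 card_mono finite_Diff)
      moreover have "card (V - U) = card V - card U" using U finU by (simp add: card_Diff_subset)
      ultimately show False using \<open>k \<le> card U\<close> half k0 by linarith
    qed
    show "\<nexists>\<chi>. two_colouring E \<chi>"
    proof
      assume "\<exists>\<chi>. two_colouring E \<chi>"
      then obtain \<chi> where \<chi>: "two_colouring E \<chi>" by blast
      note sides = regular_bipartite_sides[OF V(1,2) E(1) reg k0 \<chi>]
      have "card V > 0" using V by (simp add: card_gt_0_iff)
      then have "card {v \<in> V. \<chi> v} \<noteq> 0" using sides by linarith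
      then obtain v where v: "v \<in> V" "\<chi> v" by (metis (mono_tags, lifting) card.empty empty_Collect_eq)
      have "E `` {v} \<subseteq> {v \<in> V. \<not> \<chi> v}" using v V(2) \<chi> by (auto simp: two_colouring_def)
      then have "card (E `` {v}) \<le> card {v \<in> V. \<not> \<chi> v}" using V(1) by (intro card_mono) auto
      then have "k \<le> card {v \<in> V. \<not> \<chi> v}" using reg v by simp
      then show False using sides half by linarith
    qed
    have "2 * card V < 4 * k" using half by simp
    also have "\<dots> \<le> (2 * l + 1) * k" using l by (intro mult_le_mono1) simp
    finally show "2 * card V < (2 * l + 1) * k" .
  qed
next
  case False
  define L where "L = 2 * l + 1"
  have "even k" using even_degree_of_odd_order[OF V(1,2) False E reg] .
  then obtain k' where "k = 2 * k'" by (auto elim: evenE)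
  moreover have bigL: "2 * (card V div L) < k" using big False by (simp add: L_def)
  \<comment> \<open>Evenness of \<open>k\<close> gains one more than the strict inequality; this
    gives \<open>2 * card V < L * k\<close>.\<close>
  ultimately have "2 * (card V div L) + 2 \<le> k" by simp
  then have "L * (2 * (card V div L + 1)) \<le> L * k" by (intro mult_le_mono2) simp
  moreover have "card V < L * (card V div L + 1)"
    using dividend_less_times_div[of L "card V"] by (simp add: L_def)
  ultimately have dense: "2 * card V < L * k" by (simp add: algebra_simps)
  have k0: "0 < k" using bigL by simp
  \<comment> \<open>A smallest closed set of odd order is connected: a proper closed part or its
    complement in it would again have odd order.\<close>
  define P where "P U \<longleftrightarrow> U \<subseteq> V \<and> odd (card U) \<and> E `` U \<subseteq> U" for U
  have "P V" using False V(2) by (auto simp: P_def)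
  then obtain U where U: "P U" and min: "\<And>W. P W \<Longrightarrow> card U \<le> card W"
    using ex_has_least_nat[of P V card] by blast
  define F where "F = E \<inter> U \<times> U"
  have finU: "finite U" using U V(1) finite_subset by (auto simp: P_def)
  have FE: "F `` {v} = E `` {v}" if "v \<in> U" for v using that U by (auto simp: F_def P_def)
  have regF: "card (F `` {v}) = k" if "v \<in> U" for v using that FE reg U by (auto simp: P_def)
  have F: "F \<subseteq> U \<times> U" "sym F" "irrefl F" using E by (auto simp: F_def sym_def irrefl_def)
  have "\<exists>xs. odd_cycle F xs \<and> length xs = 2 * l - 1"
  proof (rule cycle_in_regular_nonbipartite[OF finU F regF _ _ l _ large])
    show "W = U" if W: "W \<subseteq> U" "W \<noteq> {}" "F `` W \<subseteq> W" for W
    proof (rule ccontr)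
      assume "W \<noteq> U"
      have finW: "finite W" using W finU finite_subset by blast
      have "E `` W = F `` W" using W(1) FE by blast
      then have EW: "E `` W \<subseteq> W" using W(3) by simp
      have "w \<notin> W" if "(v, w) \<in> E" "v \<notin> W" for v w
        using that EW E(1) by (meson ImageI subset_iff symD)
      then have EUW: "E `` (U - W) \<subseteq> U - W" using U by (auto simp: P_def)
      have c: "card (U - W) = card U - card W" "card W \<le> card U"
        using W finU finW by (simp_all add: card_Diff_subset card_mono)
      have "W \<subset> U" using W \<open>W \<noteq> U\<close> by blast
      then have less: "card W < card U" using finU by (simp add: psubset_card_mono)
      have "0 < card W" using W finW by (simp add: card_gt_0_iff)
      show False
      proof (cases "odd (card W)")
        case True
        then have "P W" using W U EW by (auto simp: P_def)
        then show False using min less by fastforce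
      next
        case False
        have "odd (card (U - W))" using False c U by (auto simp: P_def)
        then have "P (U - W)" using W U EUW by (auto simp: P_def)
        then show False using min[of "U - W"] c \<open>0 < card W\<close> by linarith
      qed
    qed
    show "\<nexists>\<chi>. two_colouring F \<chi>"
      using regular_bipartite_sides(2)[OF finU F(1,2) regF k0] U by (metis P_def dvd_triv_left)
    have "card U \<le> card V" using U V(1) by (simp add: P_def card_mono)
    then show "2 * card U < (2 * l + 1) * k" using dense by (simp add: L_def)
  qed
  then show ?thesis by (auto simp: odd_cycle_def F_def)
qed

lemma degree_in_regular_free_degrees_le:
  assumes "3 \<le> l" "0 < n" "k \<in> regular_free_degrees n (cycle_graph (2 * l - 1))"
    and large: "(2 * l + 1) * (2 ^ (2 * l * (2 * l + 1) + 1) * (2 * l) + 2) \<le> n"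
  shows "k \<le> (if even n then n div 2 else 2 * (n div (2 * l + 1)))"
proof (rule ccontr)
  assume "\<not> ?thesis"
  then have big: "(if even n then n div 2 else 2 * (n div (2 * l + 1))) < k" by simp
  obtain G :: "nat pair_pre_digraph" where G: "pair_graph G" "card (pverts G) = n" "k_regular k G"
    and free: "\<not> contains_graph G (cycle_graph (2 * l - 1))"
    using assms(3) by (auto simp: regular_free_degrees_def)
  interpret G: pair_graph G by (rule G)
  define N where "N = 2 ^ (2 * l * (2 * l + 1) + 1) * (2 * l)"
  have symE: "sym (parcs G)" using G.arcs_symmetric by (auto simp: sym_def)
  have irE: "irrefl (parcs G)"
  proof (rule irreflI, rule notI)
    fix v assume "(v, v) \<in> parcs G"
    from G.pair_no_loops[OF this] show False by simp
  qed
  have sub: "parcs G \<subseteq> pverts G \<times> pverts G" by (auto dest: G.in_arcsD1 G.in_arcsD2)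
  have reg: "card (parcs G `` {v}) = k" if "v \<in> pverts G" for v
  proof -
    have "out_arcs (with_proj G) v = Pair v ` (parcs G `` {v})" by (auto simp: out_arcs_def)
    then have "out_degree (with_proj G) v = card (parcs G `` {v})"
      by (simp add: out_degree_def card_image inj_on_def)
    then show ?thesis using G(3) that by (simp add: k_regular_def)
  qed
  have "N \<le> k"
  proof -
    have "N + 2 \<le> n div (2 * l + 1)"
      using large by (subst less_eq_div_iff_mult_less_eq) (auto simp: N_def ac_simps)
    moreover have "n div (2 * l + 1) \<le> n div 2" using assms(1) by (intro div_le_mono2) auto
    ultimately show ?thesis using big by (auto split: if_splits)
  qed
  moreover have "pverts G \<noteq> {}" using G(2) assms(2) by auto
  ultimately obtain xs where xs: "odd_cycle (parcs G) xs" "length xs = 2 * l - 1"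
    using cycle_in_dense_regular[OF G.pair_finite_verts sub _ symE irE reg assms(1)] big G(2)
    by (auto simp: N_def)
  have "contains_graph G (cycle_graph (2 * l - 1))"
  proof (subst contains_graph_iff[OF G.pair_wf_digraph])
    show "pair_wf_digraph (cycle_graph (2 * l - 1))"
    proof -
      interpret C: pair_graph "cycle_graph (2 * l - 1)"
        using assms(1) by (intro pair_graph_cycle_graph) simp
      show ?thesis by (rule C.pair_wf_digraph)
    qed
    have ne: "xs \<noteq> []" using odd_cycle_nonempty[OF xs(1)] .
    have arcs: "(xs ! i, xs ! (Suc i mod (2 * l - 1))) \<in> parcs G" if "i < 2 * l - 1" for i
      using that cycle_arcs_conv_nth[OF ne] xs by (force simp: odd_cycle_def)
    have "inj_on ((!) xs) {..<2 * l - 1}"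
      using xs by (auto simp: inj_on_def odd_cycle_def nth_eq_iff_index_eq)
    moreover have "xs ! i \<in> pverts G" if "i < 2 * l - 1" for i using arcs[OF that] sub by auto
    moreover have "(xs ! i, xs ! j) \<in> parcs G" if "(i, j) \<in> parcs (cycle_graph (2 * l - 1))" for i j
      using that arcs[of i] arcs[of j] symE by (auto simp: cycle_graph_def dest: symD)
    ultimately show "\<exists>f. inj_on f (pverts (cycle_graph (2 * l - 1))) \<and>
        f ` pverts (cycle_graph (2 * l - 1)) \<subseteq> pverts G \<and>
        (\<forall>(u, v) \<in> parcs (cycle_graph (2 * l - 1)). (f u, f v) \<in> parcs G)"
      by (intro exI[of _ "(!) xs"]) (auto simp: cycle_graph_def)
  qed
  then show False using free by simp
qed

section \<open>Regular graphs without short odd cycles\<close>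

text \<open>Vertices of any countable type are transported to \<open>nat\<close> by
  \<open>to_nat\<close>. The constructions below exclude even closed walks of length
  \<open>m\<close>, so \<open>h\<close> ranges over all maps, injective or not.\<close>

lemma regular_free_degreesI:
  fixes E :: "('a::countable \<times> 'a) set"
  assumes V: "finite V" "E \<subseteq> V \<times> V" "card V = n" and E: "sym E" "irrefl E"
    and reg: "\<And>v. v \<in> V \<Longrightarrow> card (E `` {v}) = k"
    and m: "2 \<le> m" and free: "\<nexists>h. \<forall>i<m. (h i, h (Suc i mod m)) \<in> E"
  shows "k \<in> regular_free_degrees n (cycle_graph m)"
proof -
  define G where "G = \<lparr> pverts = to_nat ` V, parcs = map_prod to_nat to_nat ` E \<rparr>"
  have inj: "inj_on (to_nat :: 'a \<Rightarrow> nat) A" for A by (auto simp: inj_on_def)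
  have finE: "finite E" using V by (meson finite_SigmaI finite_subset)
  have G: "pair_graph G"
  proof unfold_locales
    show "fst e \<in> pverts G" "snd e \<in> pverts G" if "e \<in> parcs G" for e
      using that V(2) by (auto simp: G_def)
    show "finite (pverts G)" "finite (parcs G)" using V(1) finE by (auto simp: G_def)
    show "fst e \<noteq> snd e" if "e \<in> parcs G" for e
      using that E(2) by (auto simp: G_def irrefl_def)
    show "symmetric (with_proj G)"
      using E(1) by (auto simp: G_def symmetric_def with_proj_def arcs_ends_conv sym_def image_iff)
        (metis map_prod_simp)+
  qed
  interpret G: pair_graph G by (rule G)
  interpret C: pair_graph "cycle_graph m" by (rule pair_graph_cycle_graph[OF m])
  have "card (pverts G) = n" using V by (simp add: G_def card_image inj)
  moreover have "k_regular k G"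
    unfolding k_regular_def
  proof
    fix x assume "x \<in> pverts G"
    then obtain v where v: "x = to_nat v" "v \<in> V" by (auto simp: G_def)
    have "out_arcs (with_proj G) x = (\<lambda>w. (x, to_nat w)) ` (E `` {v})"
      using v by (force simp: out_arcs_def G_def)
    then show "out_degree (with_proj G) x = k"
      using reg[OF v(2)] by (simp add: out_degree_def card_image inj_on_def)
  qed
  moreover have "\<not> contains_graph G (cycle_graph m)"
  proof
    assume "contains_graph G (cycle_graph m)"
    then obtain f where f: "\<forall>(u, v) \<in> parcs (cycle_graph m). (f u, f v) \<in> parcs G"
      using contains_graph_iff[OF G.pair_wf_digraph C.pair_wf_digraph] by blast
    have "(from_nat (f i), from_nat (f (Suc i mod m))) \<in> E" if "i < m" for i
    proof -
      have "(i, Suc i mod m) \<in> parcs (cycle_graph m)" using that by (simp add: cycle_graph_def)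
      then have "(f i, f (Suc i mod m)) \<in> parcs G" using f by blast
      then show ?thesis by (auto simp: G_def)
    qed
    then have "\<forall>i<m. ((from_nat \<circ> f) i, (from_nat \<circ> f) (Suc i mod m)) \<in> E" by simp
    then show False using free by blast
  qed
  ultimately show ?thesis using G unfolding regular_free_degrees_def by blast
qed

lemma complete_bipartite_free:
  assumes "odd m" "2 \<le> m"
  shows "q \<in> regular_free_degrees (2 * q) (cycle_graph m)"
proof -
  define V where "V = {..<q} \<times> (UNIV :: bool set)"
  define E where "E = {((a, x), (b, y)). a < q \<and> b < q \<and> x \<noteq> (y :: bool)}"
  show ?thesis
  proof (rule regular_free_degreesI[of V E])
    show "card V = 2 * q" by (simp add: V_def card_cartesian_product)
    show "card (E `` {v}) = q" if "v \<in> V" for v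
    proof -
      have "E `` {v} = {..<q} \<times> {\<not> snd v}" using that by (auto simp: E_def V_def)
      then show ?thesis by (simp add: card_cartesian_product)
    qed
    show "\<nexists>h. \<forall>i<m. (h i, h (Suc i mod m)) \<in> E"
    proof
      assume "\<exists>h. \<forall>i<m. (h i, h (Suc i mod m)) \<in> E"
      then obtain h where h: "(h i, h (Suc i mod m)) \<in> E" if "i < m" for i by blast
      have step: "snd (h (Suc i mod m)) = (\<not> snd (h i))" if "i < m" for i
        using h[OF that] by (auto simp: E_def)
      have par: "i < m \<longrightarrow> snd (h i) = (snd (h 0) = even i)" for i
      proof (induction i)
        case (Suc i)
        show ?case
        proof
          assume "Suc i < m"
          then have "snd (h (Suc i)) = (\<not> snd (h i))" "snd (h i) = (snd (h 0) = even i)"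
            using step[of i] Suc by simp_all
          then show "snd (h (Suc i)) = (snd (h 0) = even (Suc i))" by auto
        qed
      qed simp
      \<comment> \<open>At the even index \<open>m - 1\<close> the walk is on the side where it
        started, yet the closing arc changes sides.\<close>
      have "even (m - 1)" "m - 1 < m" "Suc (m - 1) mod m = 0" using assms by auto
      then show False using par[of "m - 1"] step[of "m - 1"] by auto
    qed
  qed (use assms in \<open>auto simp: V_def E_def sym_def irrefl_def\<close>)
qed

section \<open>Equitable distribution by residues\<close>

lemma card_residue_class_le:
  fixes k s e b :: nat
  assumes "e \<le> k * s"
  shows "card {x. x < e \<and> x mod s = b} \<le> k"
proof -
  have "{x. x < e \<and> x mod s = b} \<subseteq> (\<lambda>q. q * s + b) ` {..<k}"
  proof
    fix x assume x: "x \<in> {x. x < e \<and> x mod s = b}"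
    then have "x = x div s * s + b" by (metis (mono_tags) div_mult_mod_eq mem_Collect_eq)
    moreover have "x div s < k" using x assms by (simp add: less_mult_imp_div_less)
    ultimately show "x \<in> (\<lambda>q. q * s + b) ` {..<k}" by blast
  qed
  then have "card {x. x < e \<and> x mod s = b} \<le> card ((\<lambda>q. q * s + b) ` {..<k})"
    by (intro card_mono) auto
  also have "\<dots> \<le> k" using card_image_le[of "{..<k}"] by simp
  finally show ?thesis .
qed

lemma card_residue_class_ge:
  fixes k s e b :: nat
  assumes "k * s \<le> e" "b < s"
  shows "k \<le> card {x. x < e \<and> x mod s = b}"
proof -
  have "(\<lambda>q. q * s + b) ` {..<k} \<subseteq> {x. x < e \<and> x mod s = b}"
  proof
    fix x assume "x \<in> (\<lambda>q. q * s + b) ` {..<k}"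
    then obtain q where q: "x = q * s + b" "q < k" by blast
    have "x < Suc q * s" using q assms by simp
    also have "\<dots> \<le> k * s" using q by (intro mult_le_mono1) simp
    finally show "x \<in> {x. x < e \<and> x mod s = b}" using q assms by simp
  qed
  then have "card ((\<lambda>q. q * s + b) ` {..<k}) \<le> card {x. x < e \<and> x mod s = b}"
    by (intro card_mono) auto
  moreover have "inj_on (\<lambda>q. q * s + b) {..<k}" using assms by (auto simp: inj_on_def)
  ultimately show ?thesis by (simp add: card_image)
qed

lemma sum_card_residue_classes:
  fixes s e :: nat
  assumes "0 < s"
  shows "(\<Sum>b<s. card {x. x < e \<and> x mod s = b}) = e"
proof -
  have "(\<Sum>b<s. card {x. x < e \<and> x mod s = b}) = (\<Sum>b<s. card {x \<in> {..<e}. x mod s = b})" by simp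
  also have "\<dots> = (\<Sum>x<e. card {b \<in> {..<s}. x mod s = b})" by (intro sum_multicount_gen) auto
  also have "\<dots> = (\<Sum>x<e. card {x mod s})" using assms
    by (intro sum.cong arg_cong[where f = card]) auto
  finally show ?thesis by simp
qed

text \<open>Consecutive blocks of lengths \<open>f a\<close> are wound around a cycle of
  \<open>s\<close> positions. A block no longer than \<open>s\<close> hits distinct positions, so
  the position \<open>b\<close> lies in as many blocks as there are numbers below the total length
  with residue \<open>b\<close>.\<close>

lemma consecutive_blocks_layout:
  fixes f :: "nat \<Rightarrow> nat" and s :: nat
  defines "F \<equiv> \<lambda>a. \<Sum>a'<a. f a'"
  defines "R \<equiv> \<lambda>a. (\<lambda>x. x mod s) ` {F a..<F (Suc a)}"
  shows "f a \<le> s \<Longrightarrow> card (R a) = f a"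
    and "(\<And>a. a < m \<Longrightarrow> f a \<le> s) \<Longrightarrow>
      card {a. a < m \<and> b \<in> R a} = card {x. x < F m \<and> x mod s = b}"
proof -
  have FS: "F (Suc a) = F a + f a" for a by (simp add: F_def)
  have inj: "inj_on (\<lambda>x. x mod s) {F a..<F (Suc a)}" if "f a \<le> s" for a
    using that by (auto simp: inj_on_def FS mod_eq_window[of "F a" _ s])
  show "f a \<le> s \<Longrightarrow> card (R a) = f a"
    using card_image[OF inj] by (simp add: R_def FS)
  show "card {a. a < m \<and> b \<in> R a} = card {x. x < F m \<and> x mod s = b}"
    if "\<And>a. a < m \<Longrightarrow> f a \<le> s"
    using that
  proof (induction m)
    case 0
    then show ?case by (simp add: F_def)
  next
    case (Suc m)
    define N where "N = {x \<in> {F m..<F (Suc m)}. x mod s = b}"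
    have finN: "finite N" by (simp only: N_def) simp
    define N' where "N' = {a. a = m \<and> b \<in> R a}"
    have "{x. x < F (Suc m) \<and> x mod s = b} = {x. x < F m \<and> x mod s = b} \<union> N"
      by (auto simp: N_def FS)
    moreover have "{x. x < F m \<and> x mod s = b} \<inter> N = {}" by (auto simp: N_def)
    ultimately have cN: "card {x. x < F (Suc m) \<and> x mod s = b} = card {x. x < F m \<and> x mod s = b} + card N"
      using card_Un_disjoint[of "{x. x < F m \<and> x mod s = b}" N] finN by simp
    have "{a. a < Suc m \<and> b \<in> R a} = {a. a < m \<and> b \<in> R a} \<union> N'" by (auto simp: N'_def)
    moreover have "{a. a < m \<and> b \<in> R a} \<inter> N' = {}" by (auto simp: N'_def)
    ultimately have "card {a. a < Suc m \<and> b \<in> R a} = card {a. a < m \<and> b \<in> R a} + card N'"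
      using card_Un_disjoint[of "{a. a < m \<and> b \<in> R a}" N'] by (simp add: N'_def)
    moreover have "card N = card N'"
    proof (cases "b \<in> R m")
      case True
      then obtain x where x: "x \<in> {F m..<F (Suc m)}" "x mod s = b" by (auto simp: R_def)
      have "N = {x}" using x inj[of m] Suc.prems[of m] unfolding N_def inj_on_def by blast
      moreover have "N' = {m}" using True by (auto simp: N'_def)
      ultimately show ?thesis by simp
    next
      case False
      then have "N = {}" "N' = {}" by (auto simp: N_def N'_def R_def)
      then show ?thesis by simp
    qed
    ultimately show ?case using Suc.IH Suc.prems cN by simp
  qed
qed

section \<open>Unbalanced blow-ups of a cycle\<close>

text \<open>Between part \<open>i\<close> and the next one \<open>e i\<close> edges are laid out
  cyclically. Each vertex receives its equitable share from the previous part and sends the rest of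
  its degree \<open>k\<close> forward.\<close>

lemma ex_regular_blow_up_of_cycle:
  fixes L k :: nat and s e :: "nat \<Rightarrow> nat"
  assumes L: "3 \<le> L" and s: "\<And>i. i < L \<Longrightarrow> 0 < s i"
    and le: "\<And>i. i < L \<Longrightarrow> e i \<le> s i * s (Suc i mod L)"
    and sum: "\<And>i. i < L \<Longrightarrow> e i + e (Suc i mod L) = k * s (Suc i mod L)"
  defines "V \<equiv> Sigma {..<L} (\<lambda>i. {..<s i})"
  shows "\<exists>E. E \<subseteq> V \<times> V \<and> sym E \<and> (\<forall>v \<in> V. card (E `` {v}) = k) \<and>
    (\<forall>(u, v) \<in> E. fst v = Suc (fst u) mod L \<or> fst u = Suc (fst v) mod L)"
proof -
  define nx where "nx i = Suc i mod L" for i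
  define pr where "pr i = (if i = 0 then L - 1 else i - 1)" for i
  have nx: "nx i < L" for i using L by (simp add: nx_def)
  have pr: "pr i < L" if "i < L" for i using that L by (auto simp: pr_def)
  have nxpr: "nx (pr i) = i" if "i < L" for i using that L by (auto simp: pr_def nx_def)
  have prnx: "pr (nx i) = i" if "i < L" for i using that L by (auto simp: pr_def nx_def mod_Suc)
  have neq: "nx i \<noteq> pr i" if "i < L" for i
    using that L by (auto simp: pr_def nx_def mod_Suc)
  \<comment> \<open>The backward degree depends only on the number of edges and not on how the
    previous part sends them, so defining forward degrees from it is not circular.\<close>
  define \<beta> where "\<beta> i b = card {x. x < e (pr i) \<and> x mod s i = b}" for i b
  define f where "f i a = k - \<beta> i a" for i a
  define F where "F i a = (\<Sum>a'<a. f i a')" for i a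
  define R where "R i a = (\<lambda>x. x mod s (nx i)) ` {F i a..<F i (Suc a)}" for i a
  have sum': "e (pr i) + e i = k * s i" if "i < L" for i
    using sum[OF pr[OF that]] nxpr[OF that] by (simp add: nx_def)
  have \<beta>_le: "\<beta> i b \<le> k" if "i < L" for i b
    unfolding \<beta>_def using sum'[OF that] by (intro card_residue_class_le) simp
  have f_le: "f i b \<le> s (nx i)" if "i < L" "b < s i" for i b
  proof (cases "k \<le> s (nx i)")
    case False
    \<comment> \<open>The room condition leaves at least \<open>k - s (nx i)\<close> backward edges
      per vertex, so no forward degree exceeds the size of the next part.\<close>
    have "(k - s (nx i)) * s i = k * s i - s i * s (nx i)" by (metis diff_mult_distrib mult.commute)
    also have "\<dots> \<le> e (pr i)" using sum'[OF that(1)] le[OF that(1)] by (simp add: nx_def)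
    finally have "k - s (nx i) \<le> \<beta> i b" unfolding \<beta>_def using that(2) by (rule card_residue_class_ge)
    then show ?thesis by (simp add: f_def)
  qed (simp add: f_def)
  have F_total: "F i (s i) = e i" if "i < L" for i
  proof -
    have "F i (s i) + e (pr i) = (\<Sum>b<s i. f i b) + (\<Sum>b<s i. \<beta> i b)"
      unfolding F_def \<beta>_def using sum_card_residue_classes[OF s[OF that]] by simp
    also have "\<dots> = (\<Sum>b<s i. k)"
      unfolding sum.distrib[symmetric] using \<beta>_le[OF that] by (intro sum.cong) (auto simp: f_def)
    finally show ?thesis using sum'[OF that] by (simp add: ac_simps)
  qed
  have out: "card (R i a) = f i a" if "i < L" "a < s i" for i a
    unfolding R_def F_def by (rule consecutive_blocks_layout(1)) (rule f_le[OF that])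
  have "in": "card {a. a < s (pr i) \<and> b \<in> R (pr i) a} = \<beta> i b" if "i < L" for i b
  proof -
    have "card {a. a < s (pr i) \<and> b \<in> R (pr i) a} =
        card {x. x < F (pr i) (s (pr i)) \<and> x mod s (nx (pr i)) = b}"
      unfolding R_def F_def by (rule consecutive_blocks_layout(2)) (rule f_le[OF pr[OF that]])
    then show ?thesis using F_total[OF pr[OF that]] nxpr[OF that] by (simp add: \<beta>_def)
  qed
  have R_sub: "b < s (nx i)" if "b \<in> R i a" for i a b
    using that s[OF nx, of i] by (auto simp: R_def)
  define D where "D = {((i, a), (j, b)). i < L \<and> j = nx i \<and> a < s i \<and> b \<in> R i a}"
  define E where "E = D \<union> D\<inverse>"
  have "E \<subseteq> V \<times> V" using nx R_sub by (auto simp: E_def D_def V_def)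
  moreover have "sym E" by (auto simp: E_def sym_def)
  moreover have "card (E `` {v}) = k" if "v \<in> V" for v
  proof -
    obtain i a where v: "v = (i, a)" "i < L" "a < s i" using \<open>v \<in> V\<close> by (auto simp: V_def)
    have "D\<inverse> `` {v} = Pair (pr i) ` {a'. a' < s (pr i) \<and> a \<in> R (pr i) a'}"
      using v prnx nxpr pr by (force simp: D_def)
    moreover have "D `` {v} = Pair (nx i) ` R i a" using v by (auto simp: D_def)
    ultimately have "E `` {v} = Pair (nx i) ` R i a \<union> Pair (pr i) ` {a'. a' < s (pr i) \<and> a \<in> R (pr i) a'}"
      by (simp add: E_def Un_Image)
    moreover have "finite (R i a)" by (simp add: R_def)
    ultimately have "card (E `` {v}) = card (R i a) + card {a'. a' < s (pr i) \<and> a \<in> R (pr i) a'}"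
      using neq[OF v(2)] by (simp add: card_Un_disjoint disjoint_iff image_iff card_image inj_on_def)
    then show ?thesis using out[OF v(2,3)] "in"[OF v(2)] \<beta>_le[OF v(2)] by (simp add: f_def)
  qed
  moreover have "fst v = Suc (fst u) mod L \<or> fst u = Suc (fst v) mod L" if "(u, v) \<in> E" for u v
    using that by (auto simp: E_def D_def nx_def)
  ultimately show ?thesis by blast
qed

text \<open>Each step is 1 or -1 modulo \<open>L\<close>. The sum of these signs is divisible by
  \<open>L\<close>, at most \<open>m < L\<close> in absolute value, hence 0, but it is odd as a sum
  of \<open>m\<close> odd numbers.\<close>

lemma no_short_odd_closed_walk_in_cycle:
  fixes L m :: nat
  assumes "odd m" "m < L" and p: "\<And>i. i < m \<Longrightarrow> p i < L"
    and step: "\<And>i. i < m \<Longrightarrow> p (Suc i mod m) = Suc (p i) mod L \<or> p i = Suc (p (Suc i mod m)) mod L"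
  shows False
proof -
  have "\<exists>d :: int. \<bar>d\<bar> = 1 \<and> int L dvd int (p (Suc i mod m)) - int (p i) - d" if "i < m" for i
    using step[OF that]
  proof
    assume "p (Suc i mod m) = Suc (p i) mod L"
    then have "int (p (Suc i mod m)) - int (p i) - 1 = (int (p i) + 1) mod int L - (int (p i) + 1)"
      by (simp add: zmod_int ac_simps)
    moreover have "int L dvd (int (p i) + 1) mod int L - (int (p i) + 1)"
      by (metis dvd_minus_mod minus_diff_eq dvd_minus_iff)
    ultimately show ?thesis by (intro exI[of _ 1]) (simp only: abs_one)
  next
    let ?q = "p (Suc i mod m)"
    assume "p i = Suc ?q mod L"
    then have "int ?q - int (p i) - (- 1) = (int ?q + 1) - (int ?q + 1) mod int L"
      by (simp add: zmod_int ac_simps)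
    moreover have "int L dvd (int ?q + 1) - (int ?q + 1) mod int L" by (rule dvd_minus_mod)
    ultimately show ?thesis by (intro exI[of _ "- 1"]) (simp only: abs_minus_cancel abs_one)
  qed
  then obtain d :: "nat \<Rightarrow> int" where d: "\<And>i. i < m \<Longrightarrow> \<bar>d i\<bar> = 1"
    "\<And>i. i < m \<Longrightarrow> int L dvd int (p (Suc i mod m)) - int (p i) - d i"
    by metis
  have "(\<Sum>i<m. int (p (Suc i mod m))) = (\<Sum>i<m. int (p i))"
  proof -
    obtain m' where m': "m = Suc m'" using assms(1) by (cases m) auto
    have "(\<Sum>i<m. int (p (Suc i mod m))) = (\<Sum>i<m'. int (p (Suc i))) + int (p 0)"
      by (simp add: m')
    also have "\<dots> = (\<Sum>i<m. int (p i))" unfolding m' sum.lessThan_Suc_shift by simp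
    finally show ?thesis .
  qed
  then have "(\<Sum>i<m. int (p (Suc i mod m)) - int (p i) - d i) = - (\<Sum>i<m. d i)"
    by (simp add: sum_subtractf)
  moreover have "int L dvd (\<Sum>i<m. int (p (Suc i mod m)) - int (p i) - d i)"
    using d(2) by (intro dvd_sum) auto
  ultimately have "int L dvd (\<Sum>i<m. d i)" by simp
  moreover have "\<bar>\<Sum>i<m. d i\<bar> < int L"
  proof -
    have "\<bar>\<Sum>i<m. d i\<bar> \<le> (\<Sum>i<m. \<bar>d i\<bar>)" by (rule sum_abs)
    also have "\<dots> = int m" using d(1) by simp
    finally show ?thesis using assms(2) by simp
  qed
  ultimately have "(\<Sum>i<m. d i) = 0" using dvd_imp_le_int[of "\<Sum>i<m. d i" "int L"] by fastforce
  moreover have "odd (\<Sum>i<m. d i)"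
  proof -
    have "{i \<in> {..<m}. odd (d i)} = {..<m}"
    proof -
      have "odd (d i)" if "i < m" for i using d(1)[OF that] by (auto simp: abs_if split: if_splits)
      then show ?thesis by auto
    qed
    then show ?thesis using assms(1) by (simp add: even_sum_iff)
  qed
  ultimately show False by simp
qed

text \<open>The part sizes are \<open>q + z i\<close> and the numbers of edges between consecutive parts are
  \<open>q\<^sup>2 + q * y i\<close>. Regularity forces \<open>2 * z i = y (i - 1) + y i\<close>, so all \<open>y i\<close> have the parity of
  \<open>r\<close>, and there is room for the edges if \<open>y (i - 1) + y (i + 1) \<ge> 0\<close>. This is why \<open>y\<close> alternates
  in sign along steps of length two when \<open>r\<close> is odd.\<close>

lemma blow_up_free:
  fixes l q r :: nat
  assumes l: "3 \<le> l" and r: "r < 2 * l + 1" and q: "(2 * l + 1)\<^sup>2 \<le> q"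
  shows "2 * q \<in> regular_free_degrees ((2 * l + 1) * q + r) (cycle_graph (2 * l - 1))"
proof -
  define L where "L = 2 * l + 1"
  define c :: int where "c = (if odd r then 1 else 0)"
  define \<sigma> :: "nat \<Rightarrow> int" where "\<sigma> i = (if i mod 4 < 2 then 1 else - 1)" for i
  \<comment> \<open>The entry at 0 carries the whole surplus \<open>r\<close>. The others vanish for
    even \<open>r\<close> and are signs cancelling in consecutive pairs for odd \<open>r\<close>, so
    the sum is \<open>r\<close> in both cases.\<close>
  define y :: "nat \<Rightarrow> int" where "y i = (if i = 0 then int r else c * \<sigma> i)" for i
  define pr where "pr i = (if i = 0 then L - 1 else i - 1)" for i
  define z where "z i = (y (pr i) + y i) div 2" for i
  define s where "s i = nat (int q + z i)" for i
  define e where "e i = nat ((int q)\<^sup>2 + int q * y i)" for i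
  have \<sigma>2: "\<sigma> (i + 2) = - \<sigma> i" for i
  proof -
    have "(i + 2) mod 4 < 2 \<longleftrightarrow> \<not> i mod 4 < 2" by presburger
    then show ?thesis by (simp add: \<sigma>_def)
  qed
  have \<sigma>1: "\<sigma> i = 1 \<or> \<sigma> i = - 1" for i by (simp add: \<sigma>_def)
  have c01: "c = 0 \<or> c = 1" and cr: "c \<le> int r" by (auto simp: c_def elim: oddE)
  have par: "even (y i) \<longleftrightarrow> even r" for i using \<sigma>1[of i] by (auto simp: y_def c_def)
  have z2: "2 * z i = y (pr i) + y i" for i by (simp add: z_def par)
  have y_abs: "\<bar>y i\<bar> \<le> int (2 * l + 1)" for i
    using \<sigma>1[of i] c01 r l by (auto simp: y_def)
  have y_lower: "- 1 \<le> y i" for i using \<sigma>1[of i] c01 by (auto simp: y_def)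
  have z_abs: "\<bar>z i\<bar> \<le> int L" for i
    using z2[of i] y_abs[of i] y_abs[of "pr i"] by (simp add: L_def)
  have "L * L \<le> q" using q by (simp only: L_def power2_eq_square)
  then have qL: "int L * int L \<le> int q" by (simp only: flip: of_nat_mult of_nat_le_iff)
  have qL1: "int L < int q"
  proof -
    have "int L * 1 < int L * int L" using l by (intro mult_strict_left_mono) (auto simp: L_def)
    then show ?thesis using qL by simp
  qed
  have s_int: "int (s i) = int q + z i" for i
    using z_abs[of i] qL1 by (simp add: s_def)
  have e_int: "int (e i) = (int q)\<^sup>2 + int q * y i" for i
  proof -
    have "int q * (- 1) \<le> int q * y i" using y_lower by (intro mult_left_mono) auto
    moreover have "int q * 1 \<le> int q * int q" using qL1 by (intro mult_left_mono) auto
    ultimately have "0 \<le> (int q)\<^sup>2 + int q * y i" by (simp add: power2_eq_square)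
    then show ?thesis by (simp add: e_def)
  qed
  have prnx: "pr (Suc i mod L) = i" if "i < L" for i
    using that by (auto simp: pr_def mod_Suc L_def)
  \<comment> \<open>Near index 0 the start of the sign pattern and \<open>c \<le> r\<close> settle
    the claim; elsewhere the entries two apart cancel. The second clause serves the case without
    slack, where the product of the size corrections must not be negative.\<close>
  have room: "0 \<le> y (pr i) + y (Suc i mod L) \<and>
      (y (pr i) + y (Suc i mod L) = 0 \<longrightarrow> \<bar>y (pr i)\<bar> \<le> \<bar>y i\<bar>)" if "i < L" for i
  proof -
    have \<sigma>12: "\<sigma> 1 = 1" "\<sigma> 2 = - 1" by (simp_all add: \<sigma>_def)
    consider "i = 0" | "i = 1" | "2 \<le> i" "i < 2 * l" | "i = 2 * l"
      using \<open>i < L\<close> unfolding L_def by linarith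
    then show ?thesis
    proof cases
      case 1
      then have "pr i = 2 * l" "Suc i mod L = 1" using l by (auto simp: pr_def L_def)
      then show ?thesis using 1 l \<sigma>1[of "2 * l"] \<sigma>12 c01 cr by (auto simp: y_def)
    next
      case 2
      then have "pr i = 0" "Suc i mod L = 2" using l by (auto simp: pr_def L_def)
      then show ?thesis using 2 l \<sigma>12 c01 cr by (auto simp: y_def)
    next
      case 3
      then obtain j where j: "i = Suc j" "0 < j" by (cases i) auto
      then have "pr i = j" "Suc i mod L = j + 2" using 3 by (auto simp: pr_def L_def)
      then show ?thesis using j \<sigma>2[of j] \<sigma>1[of j] \<sigma>1[of i] c01 by (auto simp: y_def)
    next
      case 4
      then have "pr i = 2 * l - 1" "Suc i mod L = 0" using l by (auto simp: pr_def L_def)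
      then show ?thesis using 4 l \<sigma>1[of "2 * l - 1"] \<sigma>1[of "2 * l"] c01 cr by (auto simp: y_def)
    qed
  qed
  have le: "e i \<le> s i * s (Suc i mod L)" if i: "i < L" for i
  proof -
    define a b d where "a = y (pr i)" and "b = y i" and "d = y (Suc i mod L)"
    define u v where "u = z i" and "v = z (Suc i mod L)"
    have u: "2 * u = a + b" and v: "2 * v = b + d"
      using z2[of i] z2[of "Suc i mod L"] prnx[OF i] by (simp_all add: a_def b_def d_def u_def v_def)
    \<comment> \<open>This is \<open>(q + u) * (q + v)\<close> minus the number of edges, and
      \<open>2 * (u + v - b) = a + d\<close>. If \<open>a + d\<close> is positive, the term with
      \<open>q\<close> is at least \<open>q\<close>, and \<open>q\<close> is at least
      \<open>L * L\<close>, which bounds the size of \<open>u * v\<close>.\<close>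
    have "0 \<le> int q * (u + v - b) + u * v"
    proof (cases "a + d = 0")
      case True
      then have "\<bar>a\<bar> \<le> \<bar>b\<bar>" using room[OF i] by (simp add: a_def b_def d_def)
      then have "a\<^sup>2 \<le> b\<^sup>2" by (simp add: abs_le_square_iff)
      moreover have "4 * (u * v) = b\<^sup>2 - a\<^sup>2"
      proof -
        have "4 * (u * v) = (2 * u) * (2 * v)" by simp
        also have "\<dots> = (a + b) * (b - a)" using u v True by (simp add: eq_neg_iff_add_eq_0 add.commute)
        finally show ?thesis by (simp add: power2_eq_square algebra_simps)
      qed
      moreover have "u + v - b = 0" using u v True by linarith
      ultimately show ?thesis by simp
    next
      case False
      then have "0 < a + d" using room[OF i] by (simp add: a_def d_def)
      then have "1 \<le> u + v - b" using u v by linarith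
      then have "int q * 1 \<le> int q * (u + v - b)" by (intro mult_left_mono) auto
      moreover have "\<bar>u * v\<bar> \<le> int L * int L"
        unfolding abs_mult using z_abs by (intro mult_mono) (auto simp: u_def v_def)
      ultimately show ?thesis using qL by linarith
    qed
    then have "(int q)\<^sup>2 + int q * b \<le> (int q + u) * (int q + v)"
      by (simp add: power2_eq_square algebra_simps)
    then have "int (e i) \<le> int (s i * s (Suc i mod L))"
      by (simp add: e_int s_int b_def u_def v_def)
    then show ?thesis by (simp only: of_nat_le_iff)
  qed
  have sum: "e i + e (Suc i mod L) = 2 * q * s (Suc i mod L)" if i: "i < L" for i
  proof -
    have "int (e i) + int (e (Suc i mod L)) = 2 * int q * int (s (Suc i mod L))"
      using z2[of "Suc i mod L"] prnx[OF i]
      by (simp add: e_int s_int power2_eq_square algebra_simps flip: distrib_left)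
    then have "int (e i + e (Suc i mod L)) = int (2 * q * s (Suc i mod L))" by simp
    then show ?thesis by (simp only: of_nat_eq_iff)
  qed
  have "(\<Sum>i<L. y i) = int r"
  proof -
    have "(\<Sum>j<2 * h. \<sigma> (Suc j)) = 0" for h
    proof (induction h)
      case (Suc h)
      have "\<sigma> (2 * h + 1) + \<sigma> (2 * h + 2) = 0"
      proof (induction h)
        case 0
        show ?case by (simp add: \<sigma>_def)
      next
        case (Suc h)
        then show ?case using \<sigma>2[of "2 * h + 1"] \<sigma>2[of "2 * h + 2"] by simp
      qed
      then show ?case using Suc by simp
    qed simp
    then have "(\<Sum>j<2 * l. y (Suc j)) = 0"
      by (simp add: y_def flip: sum_distrib_left)
    moreover have "(\<Sum>i<L. y i) = y 0 + (\<Sum>j<2 * l. y (Suc j))"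
      unfolding L_def Suc_eq_plus1[symmetric] by (rule sum.lessThan_Suc_shift)
    ultimately show ?thesis by (simp add: y_def)
  qed
  moreover have "(\<Sum>i<L. y (pr i)) = (\<Sum>i<L. y i)"
  proof -
    have L': "L = Suc (2 * l)" by (simp add: L_def)
    have "(\<Sum>i<L. y (pr i)) = y (pr 0) + (\<Sum>i<2 * l. y (pr (Suc i)))"
      unfolding L' by (rule sum.lessThan_Suc_shift)
    also have "\<dots> = (\<Sum>i<L. y i)" by (simp add: pr_def L')
    finally show ?thesis .
  qed
  ultimately have "2 * (\<Sum>i<L. z i) = 2 * int r"
    by (simp add: sum_distrib_left z2 sum.distrib)
  then have "int (\<Sum>i<L. s i) = int (L * q + r)" by (simp add: s_int sum.distrib)
  then have total: "(\<Sum>i<L. s i) = L * q + r" by (simp only: of_nat_eq_iff)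
  have pos: "0 < s i" for i using s_int[of i] z_abs[of i] qL1 by linarith
  define V where "V = Sigma {..<L} (\<lambda>i. {..<s i})"
  obtain E where E: "E \<subseteq> V \<times> V" "sym E" "\<forall>v \<in> V. card (E `` {v}) = 2 * q"
    "\<forall>(u, v) \<in> E. fst v = Suc (fst u) mod L \<or> fst u = Suc (fst v) mod L"
    using ex_regular_blow_up_of_cycle[of L s e "2 * q"] pos le sum l unfolding V_def by (auto simp: L_def)
  have "2 * q \<in> regular_free_degrees (L * q + r) (cycle_graph (2 * l - 1))"
  proof (rule regular_free_degreesI[of V E])
    show "card V = L * q + r" using total by (simp add: V_def)
    show "irrefl E"
    proof (rule irreflI, rule notI)
      fix v assume "(v, v) \<in> E"
      then have "fst v = Suc (fst v) mod L" "fst v < L" using E(1,4) by (auto simp: V_def)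
      then show False using l by (auto simp: mod_Suc L_def split: if_splits)
    qed
    show "\<nexists>h. \<forall>i<2 * l - 1. (h i, h (Suc i mod (2 * l - 1))) \<in> E"
    proof
      assume "\<exists>h. \<forall>i<2 * l - 1. (h i, h (Suc i mod (2 * l - 1))) \<in> E"
      then obtain h where h: "\<And>i. i < 2 * l - 1 \<Longrightarrow> (h i, h (Suc i mod (2 * l - 1))) \<in> E" by blast
      show False
      proof (rule no_short_odd_closed_walk_in_cycle[of "2 * l - 1" L "\<lambda>i. fst (h i)"])
        show "fst (h i) < L" if "i < 2 * l - 1" for i using h[OF that] E(1) by (auto simp: V_def)
        show "fst (h (Suc i mod (2 * l - 1))) = Suc (fst (h i)) mod L \<or>
            fst (h i) = Suc (fst (h (Suc i mod (2 * l - 1)))) mod L" if "i < 2 * l - 1" for i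
          using h[OF that] E(4) by blast
      qed (use l in \<open>auto simp: L_def\<close>)
    qed
  qed (use E l in \<open>auto simp: V_def\<close>)
  then show ?thesis by (simp add: L_def)
qed

theorem theorem1:
  fixes l :: nat
  assumes "l \<ge> 3"
  shows "\<forall>\<^sub>F n in sequentially.
    regular_turan_number n (cycle_graph (2 * l - 1)) =
      (if even n then n div 2 else 2 * (n div (2 * l + 1)))"
proof -
  define L where "L = 2 * l + 1"
  \<comment> \<open>The first summand makes the degree large enough for the upper bound; the second
    gives \<open>n div L\<close> at least \<open>L\<close> squared for the blow-up.\<close>
  define N where "N = L * (2 ^ (2 * l * L + 1) * (2 * l) + 2) + L\<^sup>2 * L"
  have "regular_turan_number n (cycle_graph (2 * l - 1)) = (if even n then n div 2 else 2 * (n div L))"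
    if n: "N \<le> n" for n
    unfolding regular_turan_number_def
  proof (rule Max_eqI)
    have "0 < N" by (simp add: N_def L_def)
    then have n0: "0 < n" using n by simp
    show "finite (regular_free_degrees n (cycle_graph (2 * l - 1)))"
      using regular_free_degrees_less[OF n0] by (meson bounded_nat_set_is_finite)
    show "k \<le> (if even n then n div 2 else 2 * (n div L))"
      if "k \<in> regular_free_degrees n (cycle_graph (2 * l - 1))" for k
    proof -
      have "L * (2 ^ (2 * l * L + 1) * (2 * l) + 2) \<le> n" using n unfolding N_def by linarith
      then show ?thesis
        unfolding L_def by (rule degree_in_regular_free_degrees_le[OF assms n0 that])
    qed
    show "(if even n then n div 2 else 2 * (n div L)) \<in> regular_free_degrees n (cycle_graph (2 * l - 1))"
    proof (cases "even n")
      case True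
      then show ?thesis using complete_bipartite_free[of "2 * l - 1" "n div 2"] assms by auto
    next
      case False
      have "L\<^sup>2 * L \<le> n" using n by (simp add: N_def)
      then have "L\<^sup>2 \<le> n div L" by (subst less_eq_div_iff_mult_less_eq) (auto simp: L_def)
      moreover have "n mod L < L" by (simp add: L_def)
      ultimately have "2 * (n div L) \<in> regular_free_degrees (L * (n div L) + n mod L) (cycle_graph (2 * l - 1))"
        using blow_up_free[OF assms, of "n mod L" "n div L"] by (simp add: L_def)
      then show ?thesis using False by simp
    qed
  qed
  then show ?thesis unfolding eventually_sequentially L_def by blast
qed

end
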